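(* Let $\mathcal W=(\mathcal W_n)_n$ be a nonempty open domain in $\mathbb S(\mathbb R^g\times\mathbb R^g)$ and let $p(a,x)\in\mathbb R\langle a,x\rangle$ be a symmetric polynomial. If $p$ is convex in $x$ on $\mathcal W$, then $$p(a,x)=L(a,x)+V(a,x)^T Z(a)V(a,x),$$ where (i) $Z(a)$ is a square matrix-valued symmetric polynomial (in the variables $a$ only); (ii) $Z(A)\succeq 0$ for each $n$ and each $A\in\pi_a(\mathcal W_n)$; (iii) $V(a,x)$ is a column vector of polynomials whose entries are linear (homogeneous of degree one) in $x$; and (iv) $L(a,x)$ is a symmetric polynomial with degree at most one in $x$. It follows that $p(a,x)$ is convex in $x$ on the product domain $\pi_a(\mathcal W)\times\mathbb S(\mathbb R^g)$ and has degree at most two in $x$.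
   Context: Fix a positive integer $g$. $\mathbb R\langle a,x\rangle$ denotes the polynomials with real coefficients in the non-commuting variables $a=(a_1,\dots,a_g)$, $x=(x_1,\dots,x_g)$. The involution ${}^T$ on $\mathbb R\langle a,x\rangle$ is linear, reverses the order of words, and fixes each variable; $p$ is symmetric if $p^T=p$. For matrices of polynomials, ${}^T$ is the matrix transpose combined with the involution applied entrywise. $\mathbb S_n$ is the space of real symmetric $n\times n$ matrices, $\mathbb S_n(\mathbb R^g)$ is the set of $g$-tuples from $\mathbb S_n$, and $\mathbb S_n(\mathbb R^g\times\mathbb R^g)$ is the set of pairs $(A,X)$ with $A,X\in\mathbb S_n(\mathbb R^g)$. Polynomials are evaluated at $(A,X)$ by substitution (the empty word becomes $I_n$); matrix polynomials are evaluated entrywise. $P\succeq 0$ means $P$ is symmetric positive semidefinite. $\mathbb S(\mathbb R^g)=(\mathbb S_n(\mathbb R^g))_n$ and $\mathbb S(\mathbb R^g\times\mathbb R^g)=(\mathbb S_n(\mathbb R^g\times\mathbb R^g))_n$. A domain $\mathcal D=(\mathcal D_n)_n$ in one of these is a sequence of subsets $\mathcal D_n$ of the $n$-th level which is closed under direct sums: $D_1\in\mathcal D_{n_1}$ and $D_2\in\mathcal D_{n_2}$ imply $D_1\oplus D_2\in\mathcal D_{n_1+n_2}$ (coordinatewise direct sum). It is nonempty if some $\mathcal D_n$ is nonempty, and open if each $\mathcal D_n$ is open. Products are taken levelwise: $\mathcal U\times\mathcal V=(\mathcal U_n\times\mathcal V_n)_n$. The coordinate projection is $\pi_a(\mathcal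 W)=(\pi_a(\mathcal W_n))_n$ with $\pi_a(\mathcal W_n)=\{A\in\mathbb S_n(\mathbb R^g):\text{there exists }X\in\mathbb S_n(\mathbb R^g)\text{ with }(A,X)\in\mathcal W_n\}$. A symmetric polynomial $p(a,x)$ is convex in $x$ on $\mathcal W$ if for each $n$ and all $(A,X),(A,Y)\in\mathcal W_n$ such that $t(A,X)+(1-t)(A,Y)\in\mathcal W_n$ for every $0\le t\le 1$, one has $tp(A,X)+(1-t)p(A,Y)\succeq p(A,tX+(1-t)Y)$ for every $0\le t\le1$. *)

theory Defs
  imports "Jordan_Normal_Form.Matrix" "HOL-Library.Poly_Mapping"
begin

section \<open>Non-commutative polynomials\<close>

text \<open>
  Lists form the free monoid, written additively because \<^type>\<open>poly_mapping\<close> takes its monomials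
  from \<^class>\<open>monoid_add\<close>. With this instance, \<open>'v list \<Rightarrow>\<^sub>0 real\<close> carries the library's convolution
  product and is the free algebra on \<open>'v\<close>; the empty word \<open>[]\<close> is its unit monomial.
\<close>

instantiation list :: (type) monoid_add
begin
definition zero_list :: "'a list" where "0 = []"
definition plus_list :: "'a list \<Rightarrow> 'a list \<Rightarrow> 'a list" where "v + w = v @ w"
instance by standard (simp_all add: zero_list_def plus_list_def)
end

type_synonym 'v ncpoly = "'v list \<Rightarrow>\<^sub>0 real"

text \<open>
  With a finite index type \<open>'g\<close> of size \<open>g\<close>, the polynomials in the variables \<open>a\<close> alone have type
  \<open>'g ncpoly\<close>, and those in \<open>(a, x)\<close> have type \<open>('g + 'g) ncpoly\<close>, where \<open>a\<^sub>k\<close> is \<open>Inl k\<close> and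
  \<open>x\<^sub>k\<close> is \<open>Inr k\<close>.
\<close>

definition embed_a :: "'g ncpoly \<Rightarrow> ('g + 'g) ncpoly" where
  "embed_a z = (\<Sum>w \<in> Poly_Mapping.keys z.
      Poly_Mapping.single (map Inl w) (Poly_Mapping.lookup z w))"

definition invol :: "'v ncpoly \<Rightarrow> 'v ncpoly" where
  "invol p = Poly_Mapping.map_key rev p"

definition symmetric_poly :: "'v ncpoly \<Rightarrow> bool" where
  "symmetric_poly p \<longleftrightarrow> invol p = p"

definition invol_mat :: "'v ncpoly mat \<Rightarrow> 'v ncpoly mat" where
  "invol_mat P = map_mat invol (transpose_mat P)"

definition word_xdeg :: "('g + 'g) list \<Rightarrow> nat" where
  "word_xdeg w = length (filter (\<lambda>v. \<not> isl v) w)"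

text \<open>The zero polynomial gets degree \<open>0\<close>.\<close>

definition xdegree :: "('g + 'g) ncpoly \<Rightarrow> nat" where
  "xdegree p = Max (insert 0 (word_xdeg ` Poly_Mapping.keys p))"

definition x_homogeneous :: "nat \<Rightarrow> ('g + 'g) ncpoly \<Rightarrow> bool" where
  "x_homogeneous d p \<longleftrightarrow> (\<forall>w \<in> Poly_Mapping.keys p. word_xdeg w = d)"

section \<open>Evaluation at tuples of matrices\<close>

definition eval_word :: "nat \<Rightarrow> ('v \<Rightarrow> real mat) \<Rightarrow> 'v list \<Rightarrow> real mat" where
  "eval_word n T w = foldr (\<lambda>v M. T v * M) w (1\<^sub>m n)"

definition eval_poly :: "nat \<Rightarrow> ('v \<Rightarrow> real mat) \<Rightarrow> 'v ncpoly \<Rightarrow> real mat" where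
  "eval_poly n T p = mat n n (\<lambda>ij.
      \<Sum>w \<in> Poly_Mapping.keys p. Poly_Mapping.lookup p w * eval_word n T w $$ ij)"

text \<open>Entrywise evaluation: a block matrix with blocks of size \<open>n \<times> n\<close>.\<close>

definition eval_mat :: "nat \<Rightarrow> ('v \<Rightarrow> real mat) \<Rightarrow> 'v ncpoly mat \<Rightarrow> real mat" where
  "eval_mat n T P = mat (dim_row P * n) (dim_col P * n) (\<lambda>(i, j).
      eval_poly n T (P $$ (i div n, j div n)) $$ (i mod n, j mod n))"

definition eval_ax ::
  "nat \<Rightarrow> ('g \<Rightarrow> real mat) \<Rightarrow> ('g \<Rightarrow> real mat) \<Rightarrow> ('g + 'g) ncpoly \<Rightarrow> real mat" where
  "eval_ax n A X p = eval_poly n (case_sum A X) p"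

definition psd :: "nat \<Rightarrow> real mat \<Rightarrow> bool" where
  "psd n M \<longleftrightarrow> M \<in> carrier_mat n n \<and> transpose_mat M = M \<and>
     (\<forall>v \<in> carrier_vec n. 0 \<le> v \<bullet> (M *\<^sub>v v))"

section \<open>Domains\<close>

text \<open>
  A sequence of levels is a function on \<^typ>\<open>nat\<close>. Matrix sizes are positive, so every condition
  below is imposed on the levels \<open>n \<ge> 1\<close> only; the value at \<open>0\<close> is irrelevant.
\<close>

type_synonym 'g mat_tuple = "'g \<Rightarrow> real mat"
type_synonym 'g mat_pair = "'g mat_tuple \<times> 'g mat_tuple"

definition sym_tuples :: "nat \<Rightarrow> 'g mat_tuple set" where
  "sym_tuples n = {A. \<forall>k. A k \<in> carrier_mat n n \<and> transpose_mat (A k) = A k}"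

definition sym_pairs :: "nat \<Rightarrow> 'g mat_pair set" where
  "sym_pairs n = sym_tuples n \<times> sym_tuples n"

definition direct_sum :: "nat \<Rightarrow> nat \<Rightarrow> 'g mat_tuple \<Rightarrow> 'g mat_tuple \<Rightarrow> 'g mat_tuple" where
  "direct_sum m n A B = (\<lambda>k. four_block_mat (A k) (0\<^sub>m m n) (0\<^sub>m n m) (B k))"

definition is_domain :: "(nat \<Rightarrow> 'g mat_pair set) \<Rightarrow> bool" where
  "is_domain D \<longleftrightarrow>
     (\<forall>n \<ge> 1. D n \<subseteq> sym_pairs n) \<and>
     (\<forall>m \<ge> 1. \<forall>n \<ge> 1. \<forall>(A, X) \<in> D m. \<forall>(B, Y) \<in> D n.
        (direct_sum m n A B, direct_sum m n X Y) \<in> D (m + n))"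

definition nonempty_domain :: "(nat \<Rightarrow> 'g mat_pair set) \<Rightarrow> bool" where
  "nonempty_domain D \<longleftrightarrow> (\<exists>n \<ge> 1. D n \<noteq> {})"

definition tuple_close :: "nat \<Rightarrow> real \<Rightarrow> 'g mat_tuple \<Rightarrow> 'g mat_tuple \<Rightarrow> bool" where
  "tuple_close n e A B \<longleftrightarrow> (\<forall>k. \<forall>i < n. \<forall>j < n. \<bar>B k $$ (i, j) - A k $$ (i, j)\<bar> < e)"

text \<open>
  Openness relative to the finite-dimensional space of pairs of symmetric tuples. That space has a
  unique vector space topology, given here by the balls of the entrywise maximum norm.
\<close>

definition open_domain :: "(nat \<Rightarrow> ('g::finite) mat_pair set) \<Rightarrow> bool" where
  "open_domain D \<longleftrightarrow>
     (\<forall>n \<ge> 1. \<forall>(A, X) \<in> D n. \<exists>e > 0. \<forall>(B, Y) \<in> sym_pairs n.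
        tuple_close n e A B \<and> tuple_close n e X Y \<longrightarrow> (B, Y) \<in> D n)"

definition proj_a :: "(nat \<Rightarrow> 'g mat_pair set) \<Rightarrow> nat \<Rightarrow> 'g mat_tuple set" where
  "proj_a W n = {A \<in> sym_tuples n. \<exists>X \<in> sym_tuples n. (A, X) \<in> W n}"

definition product_domain ::
  "(nat \<Rightarrow> 'g mat_tuple set) \<Rightarrow> (nat \<Rightarrow> 'g mat_tuple set) \<Rightarrow> nat \<Rightarrow> 'g mat_pair set" where
  "product_domain U V n = U n \<times> V n"

definition convex_comb :: "real \<Rightarrow> 'g mat_tuple \<Rightarrow> 'g mat_tuple \<Rightarrow> 'g mat_tuple" where
  "convex_comb t X Y = (\<lambda>k. t \<cdot>\<^sub>m X k + (1 - t) \<cdot>\<^sub>m Y k)"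

definition convex_in_x :: "('g + 'g) ncpoly \<Rightarrow> (nat \<Rightarrow> 'g mat_pair set) \<Rightarrow> bool" where
  "convex_in_x p W \<longleftrightarrow>
     (\<forall>n \<ge> 1. \<forall>A X Y. (A, X) \<in> W n \<longrightarrow> (A, Y) \<in> W n \<longrightarrow>
        (\<forall>t \<in> {0..1}. (convex_comb t A A, convex_comb t X Y) \<in> W n) \<longrightarrow>
        (\<forall>t \<in> {0..1}. psd n (t \<cdot>\<^sub>m eval_ax n A X p + (1 - t) \<cdot>\<^sub>m eval_ax n A Y p
                              - eval_ax n A (convex_comb t X Y) p)))"

end

theory Submission
  imports Defs "HOL-Computational_Algebra.Polynomial"
begin

text \<open>
  Mark two occurrences of \<open>x\<close> in a word, so that it reads \<open>u\<^sup>T x\<^sub>i s x\<^sub>j t\<close>, where \<open>u\<^sup>T\<close>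
  is \<open>u\<close> reversed. The part of \<open>v\<^sup>T p(A, X + \<tau> H) v\<close> that is quadratic in \<open>\<tau>\<close> is then
  the sum over all pairs \<open>(i, u)\<close> and \<open>(j, t)\<close> of \<open>y\<^sub>i\<^sub>u\<^sup>T Z\<^sub>i\<^sub>u\<^sub>,\<^sub>j\<^sub>t(A, X) y\<^sub>j\<^sub>t\<close>.
  Here \<open>Z\<^sub>i\<^sub>u\<^sub>,\<^sub>j\<^sub>t\<close> is the polynomial whose coefficient at \<open>s\<close> is that of \<open>p\<close> at \<open>u\<^sup>T
  x\<^sub>i s x\<^sub>j t\<close>; these polynomials form the middle matrix of the Hessian. The vectors
  \<open>y\<^sub>i\<^sub>u = H\<^sub>i u(A, X) v\<close> form its border vector. Convexity on an open set makes this
  form nonnegative for every border vector that comes from some \<open>H\<close> and \<open>v\<close>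
  (\<open>hess_form_border_nonneg\<close>).

  The heart of the proof is that the form is nonnegative for \<^emph>\<open>all\<close> families \<open>y\<close>
  (\<open>hess_form_nonneg\<close>), that is, the middle matrix itself is positive semidefinite on
  the domain. Closure under direct sums gives the room needed: suppose that some point
  \<open>(B, Y)\<close> of the domain has a vector \<open>f\<close> for which the vectors \<open>w(B, Y) f\<close>, with \<open>w\<close>
  running through all short words, are linearly independent. At \<open>(A, X) \<oplus> (B, Y)\<close> and \<open>v
  = 0 \<oplus> f\<close>, all the vectors \<open>w(B, Y) f\<close> lie in the second summand, and an off-diagonal
  symmetric \<open>H\<close> can move them to arbitrarily prescribed vectors of the first. Such a
  point exists (\<open>exists_separating_point\<close>) because one can take many copies of any point
  of the domain, index the copies by words, and couple them by small multiples of
  creation and annihilation operators, as on a truncated Fock space; openness keeps the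
  result in the domain.

  The conclusions now follow. If \<open>p\<close> had degree \<open>d > 2\<close> in \<open>x\<close>, take a word \<open>u\<^sup>T x\<^sub>i s
  x\<^sub>j t\<close> of that degree with no \<open>x\<close> in \<open>u\<close> and \<open>s\<close>. The diagonal entry at \<open>(j, t)\<close> would
  need words of degree at least \<open>2 d - 2 > d\<close>, so it is zero, and positivity forces the
  entry at \<open>(i, u)\<close>, \<open>(j, t)\<close> to vanish on the domain. A polynomial that vanishes at a
  separating point is zero, a contradiction. So the degree is at most two, the middle
  matrix restricted to \<open>u\<close>, \<open>t\<close> in \<open>a\<close> alone involves only \<open>a\<close>, and with the border \<open>x\<^sub>j
  t(a)\<close> it gives exactly the part of \<open>p\<close> of degree two in \<open>x\<close>. Finally the Hessian form
  no longer depends on \<open>X\<close>, so it is nonnegative over the whole fibre of \<open>A\<close>, and a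
  polynomial of degree two in \<open>\<tau>\<close> with nonnegative leading coefficient is convex.
\<close>

section \<open>Matrices acting on coordinate functions\<close>

text \<open>
  Vectors are functions on the natural numbers of which only the first \<open>n\<close> values
  matter. This way the vectors of a direct sum and its summands share one type.
\<close>

definition dot :: "nat \<Rightarrow> (nat \<Rightarrow> real) \<Rightarrow> (nat \<Rightarrow> real) \<Rightarrow> real" where
  "dot n f g = (\<Sum>r<n. f r * g r)"

definition act :: "nat \<Rightarrow> real mat \<Rightarrow> (nat \<Rightarrow> real) \<Rightarrow> nat \<Rightarrow> real" where
  "act n M f = (\<lambda>r. \<Sum>c<n. M $$ (r, c) * f c)"

definition act_word ::
  "nat \<Rightarrow> ('v \<Rightarrow> real mat) \<Rightarrow> 'v list \<Rightarrow> (nat \<Rightarrow> real) \<Rightarrow> nat \<Rightarrow> real" where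
  "act_word n T w f = foldr (\<lambda>v. act n (T v)) w f"

lemma act_word_simps [simp]:
  "act_word n T [] f = f"
  "act_word n T (v # w) f = act n (T v) (act_word n T w f)"
  by (simp_all add: act_word_def)

lemma act_word_append: "act_word n T (u @ w) f = act_word n T u (act_word n T w f)"
  by (simp add: act_word_def)

lemma dot_cong:
  assumes "\<And>r. r < n \<Longrightarrow> f r = f' r" "\<And>r. r < n \<Longrightarrow> g r = g' r"
  shows "dot n f g = dot n f' g'"
  unfolding dot_def using assms by (intro sum.cong) auto

lemma act_cong:
  assumes "\<And>c. c < n \<Longrightarrow> M $$ (r, c) = M' $$ (r, c)" "\<And>c. c < n \<Longrightarrow> f c = f' c"
  shows "act n M f r = act n M' f' r"
  unfolding act_def using assms by (intro sum.cong) auto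

lemma dot_commute: "dot n f g = dot n g f"
  by (simp add: dot_def mult.commute)

lemma dot_add_right: "dot n f (\<lambda>r. g r + h r) = dot n f g + dot n f h"
  by (simp add: dot_def algebra_simps sum.distrib)

lemma dot_zero_right [simp]: "dot n f (\<lambda>r. 0) = 0"
  by (simp add: dot_def)

lemma act_zero [simp]: "act n M (\<lambda>r. 0) = (\<lambda>r. 0)"
  by (simp add: act_def)

lemma dot_act_symmetric:
  assumes "M \<in> carrier_mat n n" "transpose_mat M = M"
  shows "dot n f (act n M g) = dot n (act n M f) g"
proof -
  have s: "M $$ (r, c) = M $$ (c, r)" if "r < n" "c < n" for r c
    using assms that by (metis carrier_matD index_transpose_mat(1))
  have "dot n f (act n M g) = (\<Sum>r<n. \<Sum>c<n. f r * (M $$ (r, c) * g c))"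
    by (simp add: dot_def act_def sum_distrib_left)
  also have "\<dots> = (\<Sum>c<n. \<Sum>r<n. f r * (M $$ (r, c) * g c))"
    by (rule sum.swap)
  also have "\<dots> = (\<Sum>c<n. \<Sum>r<n. M $$ (c, r) * f r * g c)"
    by (intro sum.cong) (auto simp: s)
  also have "\<dots> = dot n (act n M f) g"
    by (simp add: dot_def act_def sum_distrib_right)
  finally show ?thesis .
qed

text \<open>
  Each letter acts symmetrically, so the transpose of a word is the reversed word.
\<close>

lemma dot_act_word_rev:
  assumes "T \<in> sym_tuples n"
  shows "dot n f (act_word n T w g) = dot n (act_word n T (rev w) f) g"
proof (induction w arbitrary: f)
  case (Cons v w)
  show ?case
    using assms Cons[of "act n (T v) f"]
    by (simp add: act_word_append sym_tuples_def dot_act_symmetric)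
qed simp

definition coord :: "nat \<Rightarrow> nat \<Rightarrow> real" where
  "coord c = (\<lambda>r. if r = c then 1 else 0)"

lemma act_coord: "c < n \<Longrightarrow> act n M (coord c) r = M $$ (r, c)"
  by (simp add: act_def coord_def if_distrib cong: if_cong)

lemma dot_coord: "r < n \<Longrightarrow> dot n (coord r) f = f r"
  by (simp add: dot_def coord_def if_distrib[where f = "\<lambda>a. a * _"] cong: if_cong)

lemma eval_word_carrier:
  assumes "\<And>v. T v \<in> carrier_mat n n"
  shows "eval_word n T w \<in> carrier_mat n n"
  by (induction w) (use assms in \<open>auto simp: eval_word_def intro!: mult_carrier_mat\<close>)

lemma act_eval_word:
  assumes "\<And>v. T v \<in> carrier_mat n n" "r < n"
  shows "act n (eval_word n T w) f r = act_word n T w f r"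
  using assms(2)
proof (induction w arbitrary: r)
  case Nil
  then show ?case
    by (simp add: eval_word_def act_def if_distrib[where f = "\<lambda>a. a * _"] cong: if_cong)
next
  case (Cons v w)
  have E: "eval_word n T w \<in> carrier_mat n n"
    by (rule eval_word_carrier[OF assms(1)])
  have "act n (eval_word n T (v # w)) f r
      = (\<Sum>c<n. (\<Sum>k<n. T v $$ (r, k) * eval_word n T w $$ (k, c)) * f c)"
    unfolding act_def using Cons.prems E assms(1)[of v]
    by (intro sum.cong)
       (auto simp: eval_word_def scalar_prod_def row_def col_def lessThan_atLeast0
        intro!: sum.cong)
  also have "\<dots> = (\<Sum>c<n. \<Sum>k<n. T v $$ (r, k) * (eval_word n T w $$ (k, c) * f c))"
    by (simp add: sum_distrib_right mult.assoc)
  also have "\<dots> = (\<Sum>k<n. \<Sum>c<n. T v $$ (r, k) * (eval_word n T w $$ (k, c) * f c))"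
    by (rule sum.swap)
  also have "\<dots> = (\<Sum>k<n. T v $$ (r, k) * act n (eval_word n T w) f k)"
    by (simp add: act_def sum_distrib_left)
  also have "\<dots> = act_word n T (v # w) f r"
    using Cons.IH by (simp add: act_def[of n "T v"])
  finally show ?case .
qed

definition act_poly ::
  "nat \<Rightarrow> ('v \<Rightarrow> real mat) \<Rightarrow> 'v ncpoly \<Rightarrow> (nat \<Rightarrow> real) \<Rightarrow> nat \<Rightarrow> real" where
  "act_poly n T p f r
     = (\<Sum>w\<in>Poly_Mapping.keys p. Poly_Mapping.lookup p w * act_word n T w f r)"

lemma eval_poly_carrier [simp]: "eval_poly n T p \<in> carrier_mat n n"
  by (simp add: eval_poly_def)

lemma act_eval_poly:
  assumes "\<And>v. T v \<in> carrier_mat n n" "r < n"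
  shows "act n (eval_poly n T p) f r = act_poly n T p f r"
proof -
  have "act n (eval_poly n T p) f r = (\<Sum>c<n. \<Sum>w\<in>Poly_Mapping.keys p.
          Poly_Mapping.lookup p w * (eval_word n T w $$ (r, c) * f c))"
    using assms(2) by (simp add: act_def eval_poly_def sum_distrib_right mult.assoc)
  also have "\<dots> = (\<Sum>w\<in>Poly_Mapping.keys p. \<Sum>c<n.
          Poly_Mapping.lookup p w * (eval_word n T w $$ (r, c) * f c))"
    by (rule sum.swap)
  also have "\<dots> = (\<Sum>w\<in>Poly_Mapping.keys p.
          Poly_Mapping.lookup p w * act n (eval_word n T w) f r)"
    by (simp add: act_def sum_distrib_left)
  finally show ?thesis
    using assms by (simp add: act_poly_def act_eval_word)
qed

lemma eval_poly_entry:
  assumes "\<And>v. T v \<in> carrier_mat n n" "r < n" "c < n"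
  shows "eval_poly n T p $$ (r, c) = dot n (coord r) (act_poly n T p (coord c))"
  using assms by (metis act_coord act_eval_poly dot_coord)

lemma lookup_invol: "Poly_Mapping.lookup (invol p) w = Poly_Mapping.lookup p (rev w)"
  by (simp add: invol_def map_key.rep_eq)

lemma keys_invol: "Poly_Mapping.keys (invol p) = rev ` Poly_Mapping.keys p"
proof -
  have "w \<in> Poly_Mapping.keys (invol p) \<longleftrightarrow> rev w \<in> Poly_Mapping.keys p" for w
    by (simp add: in_keys_iff lookup_invol)
  then show ?thesis
    by (metis (no_types, lifting) equalityI image_eqI image_subsetI rev_rev_ident subsetI)
qed

lemma dot_act_poly:
  "dot n f (act_poly n T p g)
     = (\<Sum>w\<in>Poly_Mapping.keys p. Poly_Mapping.lookup p w * dot n f (act_word n T w g))"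
  unfolding dot_def act_poly_def sum_distrib_left
  by (subst sum.swap) (simp add: algebra_simps)

lemma dot_act_poly_invol:
  assumes "T \<in> sym_tuples n"
  shows "dot n f (act_poly n T (invol p) g) = dot n g (act_poly n T p f)"
proof -
  have "dot n f (act_poly n T (invol p) g)
      = (\<Sum>w\<in>Poly_Mapping.keys p.
           Poly_Mapping.lookup p w * dot n f (act_word n T (rev w) g))"
    unfolding dot_act_poly keys_invol
    by (subst sum.reindex) (auto simp: lookup_invol inj_on_def)
  also have "\<dots> = dot n g (act_poly n T p f)"
    unfolding dot_act_poly
    by (simp add: dot_act_word_rev[OF assms, of f] dot_commute[of n g])
  finally show ?thesis .
qed

lemma sym_tuples_carrier: "T \<in> sym_tuples n \<Longrightarrow> T v \<in> carrier_mat n n"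
  by (simp add: sym_tuples_def)

lemma sym_tuples_iff_entry:
  "T \<in> sym_tuples n \<longleftrightarrow> (\<forall>v. T v \<in> carrier_mat n n)
     \<and> (\<forall>v r c. r < n \<longrightarrow> c < n \<longrightarrow> T v $$ (r, c) = T v $$ (c, r))" (is "_ \<longleftrightarrow> ?C \<and> ?E")
proof
  assume T: "T \<in> sym_tuples n"
  have "T v $$ (r, c) = T v $$ (c, r)" if "r < n" "c < n" for v r c
  proof -
    have "transpose_mat (T v) $$ (c, r) = T v $$ (r, c)"
      using T that by (intro index_transpose_mat) (auto simp: sym_tuples_def)
    then show ?thesis using T by (simp add: sym_tuples_def)
  qed
  then show "?C \<and> ?E" using T by (simp add: sym_tuples_def)
next
  assume T: "?C \<and> ?E"
  have "transpose_mat (T v) = T v" for v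
  proof (rule eq_matI)
    have d: "dim_row (T v) = n" "dim_col (T v) = n" using T by blast+
    show "dim_row (transpose_mat (T v)) = dim_row (T v)"
      "dim_col (transpose_mat (T v)) = dim_col (T v)" by (simp_all add: d)
    fix r c assume "r < dim_row (T v)" "c < dim_col (T v)"
    then show "transpose_mat (T v) $$ (r, c) = T v $$ (r, c)"
      using T by (simp add: d)
  qed
  then show "T \<in> sym_tuples n" using T by (simp add: sym_tuples_def)
qed

lemma sym_tuples_entry:
  "T \<in> sym_tuples n \<Longrightarrow> r < n \<Longrightarrow> c < n \<Longrightarrow> T v $$ (r, c) = T v $$ (c, r)"
  by (simp add: sym_tuples_iff_entry)

lemma eval_poly_invol:
  assumes "T \<in> sym_tuples n" "r < n" "c < n"
  shows "eval_poly n T (invol p) $$ (r, c) = eval_poly n T p $$ (c, r)"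
  using assms by (simp add: eval_poly_entry sym_tuples_carrier dot_act_poly_invol)

lemma psd_iff_dot:
  "psd n M \<longleftrightarrow> M \<in> carrier_mat n n \<and> transpose_mat M = M \<and> (\<forall>f. 0 \<le> dot n f (act n M f))"
proof -
  have 1: "v \<bullet> (M *\<^sub>v v) = dot n (vec_index v) (act n M (vec_index v))"
    if "M \<in> carrier_mat n n" "v \<in> carrier_vec n" for v
    unfolding dot_def act_def scalar_prod_def using that
    by (auto simp: scalar_prod_def lessThan_atLeast0 row_def intro!: sum.cong)
  have 2: "dot n (vec_index (vec n f)) (act n M (vec_index (vec n f))) = dot n f (act n M f)" for f
    by (intro dot_cong act_cong) auto
  show ?thesis
  proof
    assume P: "psd n M"
    have "0 \<le> dot n f (act n M f)" for f
    proof -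
      have "0 \<le> vec n f \<bullet> (M *\<^sub>v vec n f)" using P by (simp add: psd_def)
      then show ?thesis using 1[of "vec n f"] 2[of f] P by (simp add: psd_def)
    qed
    then show "M \<in> carrier_mat n n \<and> transpose_mat M = M \<and> (\<forall>f. 0 \<le> dot n f (act n M f))"
      using P by (simp add: psd_def)
  qed (simp add: psd_def 1)
qed

text \<open>
  Turns the matrix inequality that defines convexity into scalar inequalities, one for
  each test vector.
\<close>

lemma psd_eval_iff:
  assumes "S \<in> sym_tuples n" "T \<in> sym_tuples n" "R \<in> sym_tuples n" "symmetric_poly p"
  shows "psd n (s \<cdot>\<^sub>m eval_poly n S p + t \<cdot>\<^sub>m eval_poly n T p - eval_poly n R p) \<longleftrightarrow>
    (\<forall>f. 0 \<le> s * dot n f (act_poly n S p f) + t * dot n f (act_poly n T p f)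
             - dot n f (act_poly n R p f))" (is "psd n ?M \<longleftrightarrow> _")
proof -
  have sym: "transpose_mat ?M = ?M"
  proof (rule eq_matI)
    fix i j assume "i < dim_row ?M" "j < dim_col ?M"
    then have ij: "i < n" "j < n" by (auto simp: eval_poly_def)
    have "eval_poly n Q p $$ (i, j) = eval_poly n Q p $$ (j, i)" if "Q \<in> sym_tuples n" for Q
      using eval_poly_invol[OF that ij, of p] assms(4) by (simp add: symmetric_poly_def)
    then show "transpose_mat ?M $$ (i, j) = ?M $$ (i, j)"
      using ij assms(1-3) by (simp add: eval_poly_def)
  qed (simp_all add: eval_poly_def)
  have "dot n f (act n ?M f) = s * dot n f (act_poly n S p f) + t * dot n f (act_poly n T p f)
             - dot n f (act_poly n R p f)" for f
  proof -
    have "act n ?M f r = s * act_poly n S p f r + t * act_poly n T p f r - act_poly n R p f r"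
      if "r < n" for r
    proof -
      have "act n ?M f r = s * act n (eval_poly n S p) f r + t * act n (eval_poly n T p) f r
          - act n (eval_poly n R p) f r"
        unfolding act_def sum_distrib_left sum.distrib[symmetric] sum_subtractf[symmetric]
        using that by (intro sum.cong refl) (simp add: eval_poly_def algebra_simps)
      then show ?thesis
        using that assms by (simp add: act_eval_poly sym_tuples_carrier)
    qed
    then have "dot n f (act n ?M f) = dot n f
        (\<lambda>r. s * act_poly n S p f r + t * act_poly n T p f r - act_poly n R p f r)"
      by (intro dot_cong) auto
    then show ?thesis
      by (simp add: dot_def algebra_simps sum.distrib sum_subtractf sum_distrib_left)
  qed
  moreover have "?M \<in> carrier_mat n n"
    by (auto intro!: minus_carrier_mat add_carrier_mat)
  ultimately show ?thesis
    using sym by (simp add: psd_iff_dot)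
qed

section \<open>The Hessian as a quadratic form in the border vector\<close>

text \<open>
  The first two Taylor coefficients of a word along a direction in \<open>x\<close>, with the vectors
  \<open>H\<^sub>j t(A, X) v\<close> replaced by an arbitrary family \<open>y\<close>, so that positivity can be asked
  for more families than those that arise from a direction. \<open>lin_term\<close> is the sum of
  \<open>s(T) y\<^sub>j\<^sub>t\<close> over all decompositions \<open>w = s x\<^sub>j t\<close>. In \<open>quad_term\<close> the argument \<open>u\<close>
  accumulates the reversed prefix already read, which is the word that labels the left
  factor \<open>y\<^sub>i\<^sub>u\<close>.
\<close>

fun lin_term ::
  "nat \<Rightarrow> ('g + 'g \<Rightarrow> real mat) \<Rightarrow> ('g \<Rightarrow> ('g + 'g) list \<Rightarrow> nat \<Rightarrow> real)
    \<Rightarrow> ('g + 'g) list \<Rightarrow> nat \<Rightarrow> real" where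
  "lin_term n T y [] = (\<lambda>r. 0)"
| "lin_term n T y (v # w) = (\<lambda>r. (case v of Inl _ \<Rightarrow> 0 | Inr j \<Rightarrow> y j w r)
     + act n (T v) (lin_term n T y w) r)"

fun quad_term ::
  "nat \<Rightarrow> ('g + 'g \<Rightarrow> real mat) \<Rightarrow> ('g \<Rightarrow> ('g + 'g) list \<Rightarrow> nat \<Rightarrow> real)
    \<Rightarrow> ('g + 'g) list \<Rightarrow> ('g + 'g) list \<Rightarrow> real" where
  "quad_term n T y u [] = 0"
| "quad_term n T y u (v # w) = (case v of Inl _ \<Rightarrow> 0 | Inr i \<Rightarrow> dot n (y i u) (lin_term n T y w))
     + quad_term n T y (v # u) w"

definition hess_form ::
  "nat \<Rightarrow> ('g + 'g \<Rightarrow> real mat) \<Rightarrow> ('g + 'g) ncpoly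
    \<Rightarrow> ('g \<Rightarrow> ('g + 'g) list \<Rightarrow> nat \<Rightarrow> real) \<Rightarrow> real" where
  "hess_form n T p y
     = (\<Sum>w\<in>Poly_Mapping.keys p. Poly_Mapping.lookup p w * quad_term n T y [] w)"

text \<open>
  Each coordinate of \<open>w(T + \<tau> H) f\<close>, as a polynomial in \<open>\<tau>\<close>. Its Taylor coefficients are
  then plain coefficients and no derivatives are needed.
\<close>

fun line_word ::
  "nat \<Rightarrow> ('v \<Rightarrow> real mat) \<Rightarrow> ('v \<Rightarrow> real mat) \<Rightarrow> 'v list
    \<Rightarrow> (nat \<Rightarrow> real) \<Rightarrow> nat \<Rightarrow> real poly" where
  "line_word n T H [] f r = [:f r:]"
| "line_word n T H (v # w) f r
     = (\<Sum>c<n. [:T v $$ (r, c), H v $$ (r, c):] * line_word n T H w f c)"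

lemma poly_line_word:
  assumes "\<And>v r c. r < n \<Longrightarrow> c < n \<Longrightarrow> S v $$ (r, c) = T v $$ (r, c) + t * H v $$ (r, c)" "r < n"
  shows "poly (line_word n T H w f r) t = act_word n S w f r"
  using assms(2)
proof (induction w arbitrary: r)
  case (Cons v w)
  then show ?case
    using assms(1) by (auto simp: poly_sum act_def algebra_simps intro!: sum.cong)
qed simp

lemma coeff_line_word_0: "coeff (line_word n T H w f r) 0 = act_word n T w f r"
  by (induction w arbitrary: r) (auto simp: coeff_sum act_def intro!: sum.cong)

abbreviation x_direction :: "nat \<Rightarrow> 'g mat_tuple \<Rightarrow> 'g + 'g \<Rightarrow> real mat" where
  "x_direction n H \<equiv> case_sum (\<lambda>_. 0\<^sub>m n n) H"

abbreviation border ::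
  "nat \<Rightarrow> ('g + 'g \<Rightarrow> real mat) \<Rightarrow> 'g mat_tuple \<Rightarrow> (nat \<Rightarrow> real)
    \<Rightarrow> 'g \<Rightarrow> ('g + 'g) list \<Rightarrow> nat \<Rightarrow> real" where
  "border n T H f \<equiv> (\<lambda>i u. act n (H i) (act_word n T u f))"

lemma coeff_pCons_mult_Suc:
  "coeff ([:a, b::real:] * q) (Suc k) = a * coeff q (Suc k) + b * coeff q k"
  by simp

lemma coeff_line_word_1:
  assumes "r < n"
  shows "coeff (line_word n T (x_direction n H) w f r) (Suc 0)
    = lin_term n T (border n T H f) w r"
  using assms
proof (induction w arbitrary: r)
  case (Cons v w)
  have "coeff (line_word n T (x_direction n H) (v # w) f r) (Suc 0)
      = act n (T v) (lin_term n T (border n T H f) w) r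
        + act n (x_direction n H v) (act_word n T w f) r"
    unfolding line_word.simps coeff_sum coeff_pCons_mult_Suc sum.distrib
    by (simp add: act_def[of n "T v"] act_def[of n "x_direction n H v"] coeff_line_word_0 Cons.IH)
  moreover have "act n (0\<^sub>m n n) (act_word n T w f) r = 0"
    using Cons.prems by (simp add: act_def)
  ultimately show ?case
    by (cases v) simp_all
qed simp

text \<open>
  Moving the prefix \<open>u\<close> to the left side of the inner product is what makes the
  induction on \<open>w\<close> close; this uses that all matrices are symmetric.
\<close>

lemma coeff_line_word_2:
  assumes "case_sum A X \<in> sym_tuples n" "H \<in> sym_tuples n"
  shows "dot n (act_word n (case_sum A X) u f)
           (\<lambda>r. coeff (line_word n (case_sum A X) (x_direction n H) w f r) (Suc (Suc 0)))
    = quad_term n (case_sum A X) (border n (case_sum A X) H f) u w"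
proof (induction w arbitrary: u)
  case Nil
  then show ?case by simp
next
  case (Cons v w)
  define T where "T = case_sum A X"
  let ?c = "\<lambda>k r. coeff (line_word n T (x_direction n H) w f r) k"
  have T: "T v \<in> carrier_mat n n" "transpose_mat (T v) = T v" for v
    using assms(1) by (auto simp: T_def sym_tuples_def)
  have H: "H i \<in> carrier_mat n n" "transpose_mat (H i) = H i" for i
    using assms(2) by (auto simp: sym_tuples_def)
  have "coeff (line_word n T (x_direction n H) (v # w) f r) (Suc (Suc 0))
      = act n (T v) (?c (Suc (Suc 0))) r + act n (x_direction n H v) (?c (Suc 0)) r" for r
    unfolding line_word.simps coeff_sum coeff_pCons_mult_Suc sum.distrib act_def ..
  then have "dot n (act_word n T u f)
        (\<lambda>r. coeff (line_word n T (x_direction n H) (v # w) f r) (Suc (Suc 0)))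
      = dot n (act_word n T u f) (act n (T v) (?c (Suc (Suc 0))))
        + dot n (act_word n T u f) (act n (x_direction n H v) (?c (Suc 0)))"
    by (simp only: dot_add_right)
  also have "dot n (act_word n T u f) (act n (T v) (?c (Suc (Suc 0))))
      = quad_term n T (border n T H f) (v # u) w"
    using Cons[of "v # u"] T by (simp add: dot_act_symmetric T_def)
  also have "dot n (act_word n T u f) (act n (x_direction n H v) (?c (Suc 0)))
      = (case v of Inl _ \<Rightarrow> 0
         | Inr i \<Rightarrow> dot n (border n T H f i u) (lin_term n T (border n T H f) w))"
  proof (cases v)
    case (Inl k)
    have "dot n (act_word n T u f) (act n (x_direction n H v) (?c (Suc 0)))
        = dot n (act_word n T u f) (\<lambda>r. 0)"
      using Inl by (intro dot_cong) (auto simp: act_def)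
    then show ?thesis using Inl by simp
  next
    case (Inr i)
    then show ?thesis
      using H by (auto simp: dot_act_symmetric coeff_line_word_1 intro!: dot_cong)
  qed
  finally show ?case
    unfolding T_def quad_term.simps by (rule trans) (rule add.commute)
qed

lemma word_xdeg_Cons [simp]:
  "word_xdeg [] = 0"
  "word_xdeg (Inl k # w) = word_xdeg w"
  "word_xdeg (Inr k # w) = Suc (word_xdeg w)"
  by (simp_all add: word_xdeg_def)

lemma word_xdeg_append [simp]: "word_xdeg (u @ w) = word_xdeg u + word_xdeg w"
  by (simp add: word_xdeg_def)

lemma word_xdeg_rev [simp]: "word_xdeg (rev w) = word_xdeg w"
  by (simp add: word_xdeg_def rev_filter[symmetric])

lemma word_xdeg_map_Inl [simp]: "word_xdeg (map Inl w) = 0"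
  by (induction w) auto

lemma degree_line_word:
  assumes "r < n"
  shows "degree (line_word n T (x_direction n H) w f r) \<le> word_xdeg w"
  using assms
proof (induction w arbitrary: r)
  case (Cons v w)
  have "degree ([:T v $$ (r, c), x_direction n H v $$ (r, c):]
      * line_word n T (x_direction n H) w f c) \<le> word_xdeg (v # w)" if c: "c < n" for c
  proof -
    have "degree [:T v $$ (r, c), x_direction n H v $$ (r, c):] \<le> word_xdeg [v]"
      using c Cons.prems by (cases v) auto
    moreover have "degree (line_word n T (x_direction n H) w f c) \<le> word_xdeg w"
      using Cons.IH c by simp
    moreover have "word_xdeg (v # w) = word_xdeg [v] + word_xdeg w"
      using word_xdeg_append[of "[v]" w] by simp
    ultimately show ?thesis
      using degree_mult_le[of "[:T v $$ (r, c), x_direction n H v $$ (r, c):]"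
          "line_word n T (x_direction n H) w f c"] by linarith
  qed
  then show ?case
    by (auto intro!: degree_sum_le)
qed simp

definition line_form ::
  "nat \<Rightarrow> 'g mat_tuple \<Rightarrow> 'g mat_tuple \<Rightarrow> 'g mat_tuple \<Rightarrow> ('g + 'g) ncpoly
    \<Rightarrow> (nat \<Rightarrow> real) \<Rightarrow> real poly" where
  "line_form n A X H p f = (\<Sum>w\<in>Poly_Mapping.keys p. smult (Poly_Mapping.lookup p w)
     (\<Sum>r<n. smult (f r) (line_word n (case_sum A X) (x_direction n H) w f r)))"

lemma poly_line_form:
  assumes "\<And>k. X k \<in> carrier_mat n n" "\<And>k. H k \<in> carrier_mat n n"
    and "\<And>k r c. r < n \<Longrightarrow> c < n \<Longrightarrow> Y k $$ (r, c) = X k $$ (r, c) + t * H k $$ (r, c)"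
  shows "poly (line_form n A X H p f) t = dot n f (act_poly n (case_sum A Y) p f)"
proof -
  have "poly (line_word n (case_sum A X) (x_direction n H) w f r) t
      = act_word n (case_sum A Y) w f r" if "r < n" for w r
    by (rule poly_line_word) (use that assms in \<open>auto split: sum.split\<close>)
  then show ?thesis
    unfolding dot_act_poly by (simp add: line_form_def poly_sum dot_def)
qed

lemma coeff_line_form_2:
  assumes "case_sum A X \<in> sym_tuples n" "H \<in> sym_tuples n"
  shows "coeff (line_form n A X H p f) 2
    = hess_form n (case_sum A X) p (border n (case_sum A X) H f)"
  using coeff_line_word_2[OF assms, of "[]" f]
  by (simp add: line_form_def hess_form_def coeff_sum dot_def numeral_2_eq_2)

lemma word_xdeg_le_xdegree: "w \<in> Poly_Mapping.keys p \<Longrightarrow> word_xdeg w \<le> xdegree p"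
  by (simp add: xdegree_def)

lemma degree_line_form: "degree (line_form n A X H p f) \<le> xdegree p"
  unfolding line_form_def
  by (intro degree_sum_le finite_keys order_trans[OF degree_smult_le] finite_lessThan
      order_trans[OF degree_line_word word_xdeg_le_xdegree]) auto

lemma case_sum_sym_tuples [simp]:
  "case_sum A X \<in> sym_tuples n \<longleftrightarrow> A \<in> sym_tuples n \<and> X \<in> sym_tuples n"
  by (auto simp: sym_tuples_def split: sum.split_asm sum.split)

section \<open>Convexity on an open domain makes the Hessian nonnegative\<close>

text \<open>
  Odd terms cancel in the symmetric difference, so after division by \<open>t\<^sup>2\<close> it tends to
  twice the quadratic coefficient.
\<close>

lemma coeff_2_nonneg_of_midpoint_convex:
  fixes q :: "real poly"
  assumes "d > 0" and mid: "\<And>t. 0 < t \<Longrightarrow> t < d \<Longrightarrow> 0 \<le> poly q t + poly q (- t) - 2 * poly q 0"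
  shows "0 \<le> coeff q 2"
proof -
  obtain a b c s where q: "q = pCons a (pCons b (pCons c s))"
    by (metis pCons_cases)
  let ?g = "\<lambda>t. 2 * c + t * (poly s t - poly s (- t))"
  have pos: "0 \<le> ?g t" if "0 < t" "t < d" for t
  proof -
    have "poly q t + poly q (- t) - 2 * poly q 0 = t\<^sup>2 * ?g t"
      by (simp add: q power2_eq_square algebra_simps)
    then have "0 \<le> t\<^sup>2 * ?g t" using mid[OF that] by simp
    then show ?thesis using that by (simp add: zero_le_mult_iff)
  qed
  have "isCont ?g 0" by (intro continuous_intros)
  then have "(?g \<longlongrightarrow> 2 * c) (at_right 0)"
    by (auto simp: isCont_def intro: filterlim_mono[OF _ order_refl at_le])
  moreover have "eventually (\<lambda>t. 0 \<le> ?g t) (at_right 0)"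
    using assms(1) pos by (auto simp: eventually_at_right)
  ultimately have "0 \<le> 2 * c"
    by (intro tendsto_lowerbound[of ?g]) auto
  then show ?thesis
    by (simp add: q numeral_2_eq_2)
qed

text \<open>
  The segment from \<open>X - t H\<close> to \<open>X + t H\<close> stays in the open domain for small \<open>t\<close>, and
  convexity is applied at its midpoint \<open>X\<close>.
\<close>

lemma hess_form_border_nonneg:
  fixes W :: "nat \<Rightarrow> ('g::finite) mat_pair set"
  assumes W: "is_domain W" "open_domain W" and p: "symmetric_poly p" "convex_in_x p W"
    and n: "n \<ge> 1" and AX: "(A, X) \<in> W n" and H: "H \<in> sym_tuples n"
  shows "0 \<le> hess_form n (case_sum A X) p (border n (case_sum A X) H f)"
proof -
  have sym: "A \<in> sym_tuples n" "X \<in> sym_tuples n"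
    using W(1) n AX by (auto simp: is_domain_def sym_pairs_def)
  obtain e where e: "e > 0" and nbhd: "\<And>B Y. (B, Y) \<in> sym_pairs n \<Longrightarrow>
      tuple_close n e A B \<Longrightarrow> tuple_close n e X Y \<Longrightarrow> (B, Y) \<in> W n"
    using W(2) n AX unfolding open_domain_def by blast
  define C where "C = (\<Sum>k\<in>UNIV. \<Sum>i<n. \<Sum>j<n. \<bar>H k $$ (i, j)\<bar>)"
  have C: "\<bar>H k $$ (i, j)\<bar> \<le> C" if "i < n" "j < n" for k i j
  proof -
    have "\<bar>H k $$ (i, j)\<bar> \<le> (\<Sum>j<n. \<bar>H k $$ (i, j)\<bar>)"
      using that by (intro member_le_sum) auto
    also have "\<dots> \<le> (\<Sum>i<n. \<Sum>j<n. \<bar>H k $$ (i, j)\<bar>)"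
      using that by (intro member_le_sum[where f = "\<lambda>i. \<Sum>j<n. \<bar>H k $$ (i, j)\<bar>"] sum_nonneg) auto
    also have "\<dots> \<le> C" unfolding C_def
      by (intro member_le_sum[where f = "\<lambda>k. \<Sum>i<n. \<Sum>j<n. \<bar>H k $$ (i, j)\<bar>"] sum_nonneg) auto
    finally show ?thesis .
  qed
  have C0: "0 \<le> C" by (simp add: C_def sum_nonneg)
  \<comment> \<open>The summand \<open>1\<close> keeps the quotient meaningful for \<open>H = 0\<close>.\<close>
  define d where "d = e / (C + 1)"
  have d: "d > 0" using e C0 by (simp add: d_def)
  define line where "line t = (\<lambda>k. X k + t \<cdot>\<^sub>m H k)" for t
  have car: "X k \<in> carrier_mat n n" "H k \<in> carrier_mat n n" "A k \<in> carrier_mat n n" for k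
    using sym H by (auto simp: sym_tuples_def)
  have dims: "dim_row (X k) = n" "dim_col (X k) = n" "dim_row (H k) = n" "dim_col (H k) = n"
    "dim_row (A k) = n" "dim_col (A k) = n" for k
    using car[of k] by auto
  have line_entry: "line t k $$ (r, c) = X k $$ (r, c) + t * H k $$ (r, c)"
    if "r < n" "c < n" for t k r c
    using that by (simp add: line_def dims)
  have line_dims: "dim_row (line t k) = n" "dim_col (line t k) = n" for t k
    by (simp_all add: line_def dims)
  have lineD: "line t \<in> sym_tuples n" for t
  proof -
    have "line t k $$ (r, c) = line t k $$ (c, r)" if "r < n" "c < n" for k r c
      using that sym_tuples_entry[OF sym(2) that] sym_tuples_entry[OF H that]
      by (simp add: line_entry)
    then show ?thesis
      using car by (auto simp: sym_tuples_iff_entry line_def)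
  qed
  have inW: "(A', line s) \<in> W n" if "\<bar>s\<bar> < d" "A' = A" for s A'
  proof (rule nbhd)
    show "(A', line s) \<in> sym_pairs n" using sym lineD that by (simp add: sym_pairs_def)
    show "tuple_close n e A A'" using e that by (simp add: tuple_close_def)
    have "\<bar>s * H k $$ (i, j)\<bar> < e" if ij: "i < n" "j < n" for k i j
    proof -
      have "\<bar>s * H k $$ (i, j)\<bar> \<le> \<bar>s\<bar> * C" using C[OF ij] by (simp add: abs_mult mult_left_mono)
      also have "\<dots> \<le> \<bar>s\<bar> * (C + 1)" by (simp add: mult_left_mono)
      also have "\<dots> < d * (C + 1)" using that(1) \<open>\<bar>s\<bar> < d\<close> C0 by (intro mult_strict_right_mono) auto
      also have "\<dots> = e" using C0 by (simp add: d_def)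
      finally show ?thesis .
    qed
    then show "tuple_close n e X (line s)" by (simp add: tuple_close_def line_entry)
  qed
  let ?q = "line_form n A X H p f"
  have val: "poly ?q t = dot n f (act_poly n (case_sum A (line t)) p f)" for t
    by (rule poly_line_form) (use car in \<open>auto simp: line_entry\<close>)
  have "0 \<le> poly ?q t + poly ?q (- t) - 2 * poly ?q 0" if t: "0 < t" "t < d" for t
  proof -
    have comb: "convex_comb s (line t) (line (- t)) = line ((2 * s - 1) * t)" for s
      by (intro ext eq_matI) (auto simp: convex_comb_def line_entry line_dims algebra_simps)
    have combA: "convex_comb s A A = A" for s
      by (intro ext eq_matI) (auto simp: convex_comb_def dims algebra_simps)
    have small: "\<bar>(2 * s - 1) * t\<bar> < d" if "s \<in> {0..1}" for s
    proof -
      have "\<bar>2 * s - 1\<bar> \<le> 1" using that by auto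
      then have "\<bar>(2 * s - 1) * t\<bar> \<le> 1 * t"
        unfolding abs_mult using t by (intro mult_mono) auto
      then show ?thesis using t by simp
    qed
    have "psd n (1/2 \<cdot>\<^sub>m eval_ax n A (line t) p + (1 - 1/2) \<cdot>\<^sub>m eval_ax n A (line (- t)) p
        - eval_ax n A (convex_comb (1/2) (line t) (line (- t))) p)"
      using p(2)[unfolded convex_in_x_def, rule_format, OF n, of A "line t" "line (- t)" "1/2"]
        inW[of t] inW[of "- t"] t small by (auto simp: comb combA intro!: inW)
    then have "\<forall>f. 0 \<le> 1/2 * dot n f (act_poly n (case_sum A (line t)) p f)
        + (1 - 1/2) * dot n f (act_poly n (case_sum A (line (- t))) p f)
        - dot n f (act_poly n (case_sum A (line 0)) p f)"
      unfolding eval_ax_def comb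
      by (subst (asm) psd_eval_iff) (use sym lineD p(1) in auto)
    then show ?thesis unfolding val by (auto dest!: spec[of _ f])
  qed
  then have "0 \<le> coeff ?q 2"
    using d coeff_2_nonneg_of_midpoint_convex by blast
  then show ?thesis
    using coeff_line_form_2[of A X n H p f] sym H by simp
qed

section \<open>A point of the domain at which a vector has independent orbits\<close>

definition block_diag :: "nat \<Rightarrow> nat \<Rightarrow> 'g mat_tuple \<Rightarrow> 'g mat_tuple" where
  "block_diag K n A = (\<lambda>k. mat (K * n) (K * n)
     (\<lambda>(r, c). if r div n = c div n then A k $$ (r mod n, c mod n) else 0))"

lemma block_diag_Suc:
  assumes "\<And>k. A k \<in> carrier_mat n n"
  shows "block_diag (Suc K) n A = direct_sum n (K * n) A (block_diag K n A)"
proof (rule ext, rule eq_matI)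
  have d: "dim_row (A k) = n" "dim_col (A k) = n" for k using assms[of k] by auto
  fix k
  show "dim_row (block_diag (Suc K) n A k) = dim_row (direct_sum n (K * n) A (block_diag K n A) k)"
    "dim_col (block_diag (Suc K) n A k) = dim_col (direct_sum n (K * n) A (block_diag K n A) k)"
    by (simp_all add: block_diag_def direct_sum_def d)
  fix r c
  assume "r < dim_row (direct_sum n (K * n) A (block_diag K n A) k)"
    "c < dim_col (direct_sum n (K * n) A (block_diag K n A) k)"
  then have rc: "r < n + K * n" "c < n + K * n"
    by (simp_all add: block_diag_def direct_sum_def d)
  have "n > 0" using rc by (cases n) auto
  have q: "x div n = (if x < n then 0 else Suc ((x - n) div n))"
    "x mod n = (if x < n then x else (x - n) mod n)" for x
    using \<open>n > 0\<close> by (simp_all add: le_div_geq le_mod_geq)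
  have "block_diag (Suc K) n A k $$ (r, c)
      = (if r div n = c div n then A k $$ (r mod n, c mod n) else 0)"
    using rc by (simp add: block_diag_def)
  also have "\<dots> = direct_sum n (K * n) A (block_diag K n A) k $$ (r, c)"
    unfolding direct_sum_def q[of r] q[of c]
    using rc by (auto simp: d block_diag_def)
  finally show "block_diag (Suc K) n A k $$ (r, c)
      = direct_sum n (K * n) A (block_diag K n A) k $$ (r, c)" .
qed

lemma block_diag_in_domain:
  assumes W: "is_domain W" and n: "n \<ge> 1" and AX: "(A, X) \<in> W n" and "K \<ge> 1"
  shows "(block_diag K n A, block_diag K n X) \<in> W (K * n)"
  using \<open>K \<ge> 1\<close>
proof (induction K rule: nat_induct_at_least)
  have c: "A k \<in> carrier_mat n n" "X k \<in> carrier_mat n n" for k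
    using W n AX by (auto simp: is_domain_def sym_pairs_def sym_tuples_def)
  {
    case base
    have "block_diag 1 n B = B" if "\<And>k. B k \<in> carrier_mat n n" for B :: "'a \<Rightarrow> real mat"
      using that[THEN carrier_matD(1)] that[THEN carrier_matD(2)]
      by (intro ext eq_matI) (auto simp: block_diag_def)
    then show ?case using AX c by simp
  next
    case (Suc K)
    have "K * n \<ge> 1" using Suc.hyps n by simp
    then have "(direct_sum n (K * n) A (block_diag K n A),
        direct_sum n (K * n) X (block_diag K n X)) \<in> W (n + K * n)"
      using W n AX Suc.IH unfolding is_domain_def by blast
    then show ?case using c by (simp add: block_diag_Suc)
  }
qed

text \<open>
  Index the blocks of a large multiple of a point of the domain by the words of length
  at most \<open>D\<close>. Add a small multiple of the operator that joins the block of \<open>w\<close> to the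
  block of \<open>v w\<close>, for each letter \<open>v\<close>. Starting from a unit vector \<open>f\<close> in the block of
  the empty word, the word \<open>w\<close> produces a vector with no component in blocks of longer
  words, and among the blocks of words of length equal to that of \<open>w\<close> only the one of
  \<open>w\<close> itself is reached. This triangular shape makes the vectors \<open>w f\<close> linearly
  independent; the \<open>d u\<close> are a dual system.
\<close>

lemma exists_separating_point:
  fixes W :: "nat \<Rightarrow> ('g::finite) mat_pair set"
  assumes W: "is_domain W" "nonempty_domain W" "open_domain W"
  obtains m B Y f d where "m \<ge> 1" "(B, Y) \<in> W m"
    "\<And>u w. length u \<le> D \<Longrightarrow> length w \<le> D \<Longrightarrow>
       dot m (d u) (act_word m (case_sum B Y) w f) = (if u = w then 1 else 0)"
proof -
  obtain n A X where n: "n \<ge> 1" and AX: "(A, X) \<in> W n"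
    using W(2) by (auto simp: nonempty_domain_def)
  have symAX: "A \<in> sym_tuples n" "X \<in> sym_tuples n"
    using W(1) n AX by (auto simp: is_domain_def sym_pairs_def)
  let ?words = "{w :: ('g + 'g) list. length w \<le> D}"
  have fin: "finite ?words"
    using finite_lists_length_le[of "UNIV :: ('g + 'g) set" D] by simp
  obtain ws where ws: "set ws = ?words" "distinct ws"
    using finite_distinct_list[OF fin] by blast
  define K where "K = length ws"
  have K: "K \<ge> 1"
  proof -
    have "[] \<in> set ws" by (simp add: ws)
    then show ?thesis unfolding K_def by (cases ws) auto
  qed
  define m where "m = K * n"
  have m: "m \<ge> 1" using K n by (simp add: m_def)
  obtain e where e: "e > 0" and nbhd: "\<And>B Y. (B, Y) \<in> sym_pairs m \<Longrightarrow>
      tuple_close m e (block_diag K n A) B \<Longrightarrow> tuple_close m e (block_diag K n X) Y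
      \<Longrightarrow> (B, Y) \<in> W m"
    using W(3) m block_diag_in_domain[OF W(1) n AX K]
    unfolding open_domain_def m_def by blast
  define eps where "eps = e / 2"
  define wd where "wd r = ws ! (r div n)" for r
  define near where "near v r c \<longleftrightarrow> r mod n = c mod n \<and> (wd r = v # wd c \<or> wd c = v # wd r)"
    for v r c
  define T where "T v = mat m m (\<lambda>(r, c).
      (if r div n = c div n then case_sum A X v $$ (r mod n, c mod n) else 0)
      + (if near v r c then eps else 0))" for v
  have T_entry: "T v $$ (r, c) =
      (if r div n = c div n then case_sum A X v $$ (r mod n, c mod n) else 0)
      + (if near v r c then eps else 0)" if "r < m" "c < m" for v r c
    using that by (simp add: T_def)
  have wd_len: "length (wd r) \<le> D" if "r < m" for r
  proof -
    have "r div n < length ws" using that n by (simp add: m_def K_def less_mult_imp_div_less)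
    then show ?thesis using ws(1) nth_mem unfolding wd_def by blast
  qed
  define idx where "idx w = (THE i. i < K \<and> ws ! i = w)" for w
  have idx: "idx w < K" "ws ! idx w = w" if "length w \<le> D" for w
  proof -
    have "\<exists>!i. i < K \<and> ws ! i = w"
      using that ws unfolding K_def by (intro distinct_Ex1) auto
    from theI'[OF this] show "idx w < K" "ws ! idx w = w" by (simp_all add: idx_def)
  qed
  have node: "idx w * n < m" if "length w \<le> D" for w
    using idx(1)[OF that] n by (simp add: m_def)
  have node_iff: "wd c = w \<and> c mod n = 0 \<longleftrightarrow> c = idx w * n" if "c < m" "length w \<le> D" for c w
  proof
    assume c: "wd c = w \<and> c mod n = 0"
    have "c div n < K" using that(1) n by (simp add: m_def less_mult_imp_div_less)
    then have "c div n = idx w"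
      using c idx[OF that(2)] ws(2) nth_eq_iff_index_eq unfolding wd_def K_def by metis
    then show "c = idx w * n" using c by (metis add.right_neutral div_mult_mod_eq)
  qed (use idx[OF that(2)] n in \<open>simp add: wd_def\<close>)
  let ?f = "coord (idx [] * n)"
  \<comment> \<open>Only a creation step can reach a block at maximal height, and it prepends \<open>v\<close>.\<close>
  have tri: "act_word m T w ?f r = (if r = idx w * n then eps ^ length w else 0)"
    if "length w \<le> length (wd r)" "r < m" for w r
    using that
  proof (induction w arbitrary: r)
    case Nil
    then show ?case by (simp add: coord_def)
  next
    case (Cons v w)
    let ?g = "act_word m T w ?f"
    have wD: "length (v # w) \<le> D" using Cons.prems wd_len order_trans by blast
    have "T v $$ (r, c) * ?g c
        = (if c = idx w * n then if r = idx (v # w) * n then eps ^ Suc (length w) else 0 else 0)"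
      if c: "c < m" for c
    proof (cases "length w \<le> length (wd c)")
      case True
      then have g: "?g c = (if c = idx w * n then eps ^ length w else 0)"
        using Cons.IH c by simp
      show ?thesis
      proof (cases "c = idx w * n")
        case False
        then show ?thesis using g by simp
      next
        case True
        have w: "wd c = w" "c mod n = 0"
          using node_iff[of c w] True c wD by auto
        have "r div n \<noteq> c div n"
          using Cons.prems(1) w(1) by (auto simp: wd_def)
        moreover have "near v r c \<longleftrightarrow> r = idx (v # w) * n"
          using node_iff[OF Cons.prems(2) wD] Cons.prems(1) w by (auto simp: near_def)
        ultimately show ?thesis
          using True g c Cons.prems(2) by (simp add: T_entry)
      qed
    next
      case False
      then have "r div n \<noteq> c div n" "\<not> near v r c"
        using Cons.prems(1) by (auto simp: near_def wd_def)
      moreover have "c \<noteq> idx w * n"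
        using False node_iff[of c w] c wD by auto
      ultimately show ?thesis
        using c Cons.prems(2) by (simp add: T_entry)
    qed
    then have "act_word m T (v # w) ?f r = (\<Sum>c<m.
        if c = idx w * n then if r = idx (v # w) * n then eps ^ Suc (length w) else 0 else 0)"
      by (simp add: act_def)
    also have "\<dots> = (if r = idx (v # w) * n then eps ^ length (v # w) else 0)"
      using node[of w] wD by simp
    finally show ?case .
  qed
  \<comment> \<open>Invert the triangular system, from the longest words down to the empty one.\<close>
  have dual: "\<exists>d. \<forall>w. length w \<le> D \<longrightarrow>
      dot m d (act_word m T w ?f) = (if u = w then 1 else 0)" if "length u \<le> D" for u
    using that
  proof (induction "D - length u" arbitrary: u rule: less_induct)
    case less
    let ?S = "{u' :: ('g + 'g) list. length u < length u' \<and> length u' \<le> D}"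
    have finS: "finite ?S" by (rule finite_subset[OF _ fin]) auto
    have "\<forall>u'\<in>?S. \<exists>d. \<forall>w. length w \<le> D \<longrightarrow>
        dot m d (act_word m T w ?f) = (if u' = w then 1 else 0)"
      by (intro ballI less.hyps) auto
    from bchoice[OF this] obtain d where d: "\<And>u' w. u' \<in> ?S \<Longrightarrow> length w \<le> D \<Longrightarrow>
        dot m (d u') (act_word m T w ?f) = (if u' = w then 1 else 0)"
      by blast
    let ?c = "\<lambda>w. act_word m T w ?f (idx u * n)"
    define d' where "d' r = (coord (idx u * n) r - (\<Sum>u'\<in>?S. ?c u' * d u' r)) / eps ^ length u" for r
    have "dot m d' (act_word m T w ?f) = (if u = w then 1 else 0)" if w: "length w \<le> D" for w
    proof -
      have "dot m d' (act_word m T w ?f) * eps ^ length u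
          = dot m (coord (idx u * n)) (act_word m T w ?f)
            - (\<Sum>u'\<in>?S. ?c u' * dot m (d u') (act_word m T w ?f))"
      proof -
        have "dot m d' (act_word m T w ?f) * eps ^ length u
            = (\<Sum>r<m. (coord (idx u * n) r - (\<Sum>u'\<in>?S. ?c u' * d u' r)) * act_word m T w ?f r)"
          unfolding dot_def sum_distrib_right using e
          by (intro sum.cong) (simp_all add: d'_def eps_def)
        also have "\<dots> = dot m (coord (idx u * n)) (act_word m T w ?f)
            - (\<Sum>r<m. \<Sum>u'\<in>?S. ?c u' * d u' r * act_word m T w ?f r)"
          by (simp add: dot_def left_diff_distrib sum_subtractf sum_distrib_right)
        also have "(\<Sum>r<m. \<Sum>u'\<in>?S. ?c u' * d u' r * act_word m T w ?f r)
            = (\<Sum>u'\<in>?S. ?c u' * dot m (d u') (act_word m T w ?f))"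
          by (subst sum.swap) (simp add: dot_def sum_distrib_left mult.assoc)
        finally show ?thesis .
      qed
      also have "dot m (coord (idx u * n)) (act_word m T w ?f) = ?c w"
        using node less.prems by (simp add: dot_coord)
      also have "(\<Sum>u'\<in>?S. ?c u' * dot m (d u') (act_word m T w ?f))
          = (\<Sum>u'\<in>?S. if u' = w then ?c w else 0)"
        using w by (intro sum.cong) (auto simp: d)
      also have "\<dots> = (if w \<in> ?S then ?c w else 0)"
        using finS by simp
      also have "?c w - (if w \<in> ?S then ?c w else 0) = (if u = w then eps ^ length u else 0)"
      proof (cases "w \<in> ?S")
        case False
        then have "length w \<le> length (wd (idx u * n))"
          using w idx[OF less.prems] n by (auto simp: wd_def)
        then have "?c w = (if idx u * n = idx w * n then eps ^ length w else 0)"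
          using node less.prems by (simp add: tri)
        moreover have "idx u * n = idx w * n \<longleftrightarrow> u = w"
        proof
          assume "idx u * n = idx w * n"
          then have "ws ! idx u = ws ! idx w" using n by simp
          then show "u = w" using idx(2)[OF less.prems] idx(2)[OF w] by simp
        qed simp
        ultimately show ?thesis using False by auto
      qed auto
      finally show ?thesis
        using e by (cases "u = w") (simp_all add: eps_def)
    qed
    then show ?case by blast
  qed
  then have "\<forall>u\<in>?words. \<exists>d. \<forall>w. length w \<le> D \<longrightarrow>
      dot m d (act_word m T w ?f) = (if u = w then 1 else 0)"
    by blast
  from bchoice[OF this] obtain d where d: "\<And>u w. length u \<le> D \<Longrightarrow> length w \<le> D \<Longrightarrow>
      dot m (d u) (act_word m T w ?f) = (if u = w then 1 else 0)"
    by blast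
  have symT: "T \<in> sym_tuples m"
  proof -
    have "T v $$ (r, c) = T v $$ (c, r)" if rc: "r < m" "c < m" for v r c
    proof -
      have "near v r c \<longleftrightarrow> near v c r" by (auto simp: near_def)
      moreover have "case_sum A X v $$ (r mod n, c mod n) = case_sum A X v $$ (c mod n, r mod n)"
        using symAX n by (intro sym_tuples_entry[of _ n]) auto
      ultimately show ?thesis by (simp add: T_entry rc)
    qed
    moreover have "T v \<in> carrier_mat m m" for v by (simp add: T_def)
    ultimately show ?thesis unfolding sym_tuples_iff_entry by blast
  qed
  have T_split: "case_sum (\<lambda>k. T (Inl k)) (\<lambda>k. T (Inr k)) = T"
    by (auto split: sum.split)
  have "((\<lambda>k. T (Inl k)), (\<lambda>k. T (Inr k))) \<in> W m"
  proof (rule nbhd)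
    show "((\<lambda>k. T (Inl k)), (\<lambda>k. T (Inr k))) \<in> sym_pairs m"
      using symT by (simp add: sym_pairs_def sym_tuples_def)
    show "tuple_close m e (block_diag K n A) (\<lambda>k. T (Inl k))"
      "tuple_close m e (block_diag K n X) (\<lambda>k. T (Inr k))"
      using e by (auto simp: tuple_close_def T_entry block_diag_def m_def[symmetric] eps_def)
  qed
  moreover have "dot m (d u) (act_word m (case_sum (\<lambda>k. T (Inl k)) (\<lambda>k. T (Inr k))) w ?f)
      = (if u = w then 1 else 0)" if "length u \<le> D" "length w \<le> D" for u w
    unfolding T_split by (rule d[OF that])
  ultimately show thesis using m that by blast
qed

section \<open>The Hessian form is nonnegative for all border vectors\<close>

lemma sum_lessThan_add:
  "(\<Sum>c<n + m. g c) = (\<Sum>c<n. g c) + (\<Sum>c<m. g (n + c))" for g :: "nat \<Rightarrow> real"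
  by (induction m) (simp_all add: algebra_simps)

lemma act_blocks:
  assumes "\<And>r c. r < n \<Longrightarrow> c < n \<Longrightarrow> M $$ (r, c) = P $$ (r, c)"
    and "\<And>r c. r < n \<Longrightarrow> c < m \<Longrightarrow> M $$ (r, n + c) = 0"
    and "\<And>r c. r < m \<Longrightarrow> c < n \<Longrightarrow> M $$ (n + r, c) = 0"
    and "\<And>r c. r < m \<Longrightarrow> c < m \<Longrightarrow> M $$ (n + r, n + c) = Q $$ (r, c)"
    and "r < n + m"
  shows "act (n + m) M g r = (if r < n then act n P g r else act m Q (\<lambda>c. g (n + c)) (r - n))"
proof (cases "r < n")
  case True
  then show ?thesis by (simp add: act_def sum_lessThan_add assms(1,2))
next
  case False
  then obtain r' where r: "r = n + r'" "r' < m"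
    using assms(5) by (metis add_less_cancel_left le_Suc_ex not_less)
  then show ?thesis by (simp add: act_def sum_lessThan_add assms(3,4))
qed

text \<open>
  The direction \<open>H\<close> below is off-diagonal with respect to \<open>(A, X) \<oplus> (B, Y)\<close>. Its corner
  \<open>G\<close> maps \<open>w(B, Y) f\<close> to \<open>y i w\<close>, by means of the dual system. The opposite corner, the
  transpose of \<open>G\<close>, acts on first components, and these vanish for the test vector \<open>0 \<oplus>
  f\<close> and all its images under words.
\<close>

lemma hess_form_nonneg:
  fixes W :: "nat \<Rightarrow> ('g::finite) mat_pair set"
  assumes W: "is_domain W" "nonempty_domain W" "open_domain W"
    and p: "symmetric_poly p" "convex_in_x p W"
    and n: "n \<ge> 1" and AX: "(A, X) \<in> W n"
  shows "0 \<le> hess_form n (case_sum A X) p y"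
proof -
  define D where "D = Max (insert 0 (length ` Poly_Mapping.keys p))"
  have D: "length w \<le> D" if "w \<in> Poly_Mapping.keys p" for w
    using that by (simp add: D_def)
  obtain m B Y f d where m: "m \<ge> 1" and BY: "(B, Y) \<in> W m"
    and d: "\<And>u w. length u \<le> D \<Longrightarrow> length w \<le> D \<Longrightarrow>
       dot m (d u) (act_word m (case_sum B Y) w f) = (if u = w then 1 else 0)"
    by (rule exists_separating_point[OF W, of D]) blast
  let ?S = "case_sum A X" and ?R = "case_sum B Y"
  let ?T = "case_sum (direct_sum n m A B) (direct_sum n m X Y)"
  have sym: "?S \<in> sym_tuples n" "?R \<in> sym_tuples m"
    using W(1) n AX m BY by (auto simp: is_domain_def sym_pairs_def)
  have T_in: "(direct_sum n m A B, direct_sum n m X Y) \<in> W (n + m)"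
    using W(1) n m AX BY unfolding is_domain_def by blast
  have actT: "act (n + m) (?T v) g r
      = (if r < n then act n (?S v) g r else act m (?R v) (\<lambda>c. g (n + c)) (r - n))"
    if "r < n + m" for v g r
  proof -
    have dims: "dim_row (?S v) = n" "dim_col (?S v) = n" "dim_row (?R v) = m" "dim_col (?R v) = m"
      using sym by (auto simp: sym_tuples_def)
    have "?T v = four_block_mat (?S v) (0\<^sub>m n m) (0\<^sub>m m n) (?R v)"
      by (cases v) (simp_all add: direct_sum_def)
    then show ?thesis
      by (intro act_blocks that) (simp_all add: dims)
  qed
  let ?words = "{u :: ('g + 'g) list. length u \<le> D}"
  have fin: "finite ?words"
    using finite_lists_length_le[of "UNIV :: ('g + 'g) set" D] by simp
  define G where "G i r c = (\<Sum>u\<in>?words. y i u r * d u c)" for i r c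
  define H where "H i = mat (n + m) (n + m) (\<lambda>(r, c).
      if r < n \<and> n \<le> c then G i r (c - n) else if n \<le> r \<and> c < n then G i c (r - n) else 0)" for i
  have H: "H \<in> sym_tuples (n + m)"
    unfolding sym_tuples_iff_entry by (auto simp: H_def)
  define v where "v r = (if r < n then 0 else f (r - n))" for r
  have orbit: "act_word (n + m) ?T w v r = (if r < n then 0 else act_word m ?R w f (r - n))"
    if "r < n + m" for w r
    using that
  proof (induction w arbitrary: r)
    case Nil
    then show ?case by (simp add: v_def)
  next
    case (Cons l w)
    have 1: "act n (?S l) (act_word (n + m) ?T w v) r = act n (?S l) (\<lambda>c. 0) r"
      by (rule act_cong) (simp_all add: Cons.IH)
    have 2: "act m (?R l) (\<lambda>c. act_word (n + m) ?T w v (n + c)) (r - n)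
        = act m (?R l) (act_word m ?R w f) (r - n)"
      by (rule act_cong) (simp_all add: Cons.IH)
    show ?case
      unfolding act_word_simps actT[OF Cons.prems] 1 2 by simp
  qed
  have border: "act (n + m) (H i) (act_word (n + m) ?T u v) r = (if r < n then y i u r else 0)"
    if u: "length u \<le> D" and r: "r < n + m" for i u r
  proof -
    have "act (n + m) (H i) (act_word (n + m) ?T u v) r
        = (\<Sum>c<m. H i $$ (r, n + c) * act_word m ?R u f c)"
      using r by (simp add: act_def[of "n + m" "H i"] sum_lessThan_add orbit)
    also have "\<dots> = (if r < n then \<Sum>c<m. G i r c * act_word m ?R u f c else 0)"
      using r by (auto simp: H_def)
    also have "(\<Sum>c<m. G i r c * act_word m ?R u f c)
        = (\<Sum>u'\<in>?words. y i u' r * dot m (d u') (act_word m ?R u f))"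
      unfolding G_def sum_distrib_right dot_def sum_distrib_left
      by (subst sum.swap) (simp add: mult.assoc)
    also have "\<dots> = (\<Sum>u'\<in>?words. if u' = u then y i u r else 0)"
      using u by (intro sum.cong) (auto simp: d)
    also have "\<dots> = y i u r"
      using u fin by simp
    finally show ?thesis .
  qed
  let ?b = "border (n + m) ?T H v"
  have lin: "lin_term (n + m) ?T ?b w r = (if r < n then lin_term n ?S y w r else 0)"
    if "length w \<le> D" "r < n + m" for w r
    using that
  proof (induction w arbitrary: r)
    case (Cons l w)
    have 1: "act n (?S l) (lin_term (n + m) ?T ?b w) r = act n (?S l) (lin_term n ?S y w) r"
      using Cons.prems by (intro act_cong) (simp_all add: Cons.IH)
    have 2: "act m (?R l) (\<lambda>c. lin_term (n + m) ?T ?b w (n + c)) (r - n) = act m (?R l) (\<lambda>c. 0) (r - n)"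
      using Cons.prems by (intro act_cong) (simp_all add: Cons.IH)
    show ?case
      unfolding lin_term.simps actT[OF Cons.prems(2)] 1 2
      using Cons.prems by (auto simp: border split: sum.split)
  qed simp
  have dot_top: "dot (n + m) g h = dot n g' h'"
    if "\<And>r. r < n + m \<Longrightarrow> g r = (if r < n then g' r else 0)"
      "\<And>r. r < n + m \<Longrightarrow> h r = (if r < n then h' r else 0)" for g h g' h'
    using that by (simp add: dot_def sum_lessThan_add)
  have quad: "quad_term (n + m) ?T ?b u w = quad_term n ?S y u w" if "length u + length w \<le> D" for u w
    using that
  proof (induction w arbitrary: u)
    case (Cons l w)
    have "dot (n + m) (?b i u) (lin_term (n + m) ?T ?b w) = dot n (y i u) (lin_term n ?S y w)" for i
      by (rule dot_top) (use Cons.prems in \<open>simp_all add: border lin\<close>)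
    then show ?case
      using Cons.IH[of "l # u"] Cons.prems by (simp split: sum.split)
  qed simp
  have "0 \<le> hess_form (n + m) ?T p ?b"
    using hess_form_border_nonneg[OF W(1,3) p _ T_in H] n by simp
  also have "\<dots> = hess_form n ?S p y"
    unfolding hess_form_def by (intro sum.cong refl) (simp add: quad D)
  finally show ?thesis .
qed

section \<open>The Hessian form as a block matrix\<close>

definition x_splits :: "('g + 'g) list \<Rightarrow> (('g + 'g) list \<times> 'g \<times> ('g + 'g) list) set" where
  "x_splits w = {(s, j, t). w = s @ Inr j # t}"

lemma x_splits_Nil: "x_splits [] = {}"
  by (auto simp: x_splits_def)

lemma x_splits_Cons:
  "x_splits (v # w) = (case v of Inl _ \<Rightarrow> {} | Inr j \<Rightarrow> {([], j, w)})
     \<union> (\<lambda>(s, j, t). (v # s, j, t)) ` x_splits w"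
  by (auto simp: x_splits_def Cons_eq_append_conv split: sum.split)

lemma finite_x_splits [simp]: "finite (x_splits w)"
  by (induction w) (auto simp: x_splits_Nil x_splits_Cons split: sum.split)

lemma sum_x_splits_Cons:
  "(\<Sum>(s, j, t)\<in>x_splits (v # w). g s j t)
     = (case v of Inl _ \<Rightarrow> 0 | Inr j \<Rightarrow> g [] j w) + (\<Sum>(s, j, t)\<in>x_splits w. g (v # s) j t)"
  for g :: "_ \<Rightarrow> _ \<Rightarrow> _ \<Rightarrow> real"
proof -
  have inj: "inj_on (\<lambda>(s, j, t). (v # s, j, t)) (x_splits w)"
    by (auto simp: inj_on_def)
  have "(\<Sum>(s, j, t)\<in>(\<lambda>(s, j, t). (v # s, j, t)) ` x_splits w. g s j t)
      = (\<Sum>(s, j, t)\<in>x_splits w. g (v # s) j t)"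
    unfolding sum.reindex[OF inj] by (simp add: case_prod_unfold comp_def)
  then show ?thesis
    unfolding x_splits_Cons by (subst sum.union_disjoint) (auto split: sum.split)
qed

lemma act_word_zero [simp]: "act_word n T w (\<lambda>r. 0) = (\<lambda>r. 0)"
  by (induction w) auto

lemma dot_zero_left [simp]: "dot n (\<lambda>r. 0) f = 0"
  by (simp add: dot_def)

lemma act_sum: "act n M (\<lambda>c. \<Sum>x\<in>S. g x c) r = (\<Sum>x\<in>S. act n M (g x) r)"
  unfolding act_def sum_distrib_left by (rule sum.swap)

lemma lin_term_eq_sum:
  "lin_term n T y w r = (\<Sum>(s, j, t)\<in>x_splits w. act_word n T s (y j t) r)"
proof (induction w arbitrary: r)
  case (Cons v w)
  have "act n (T v) (lin_term n T y w) r
      = act n (T v) (\<lambda>c. \<Sum>x\<in>x_splits w. act_word n T (fst x) (y (fst (snd x)) (snd (snd x))) c) r"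
    by (intro act_cong) (simp_all add: Cons.IH case_prod_unfold)
  then show ?case
    unfolding sum_x_splits_Cons lin_term.simps act_sum
    by (simp add: case_prod_unfold split: sum.split)
qed (simp add: x_splits_Nil)

lemma quad_term_eq_sum:
  "quad_term n T y u w = (\<Sum>(s, i, t)\<in>x_splits w. dot n (y i (rev s @ u)) (lin_term n T y t))"
  by (induction w arbitrary: u) (simp_all add: x_splits_Nil sum_x_splits_Cons split: sum.split)

text \<open>
  An entry of the middle matrix: the coefficient of \<open>s\<close> is the coefficient of \<open>p\<close> at
  \<open>u\<^sup>T x\<^sub>i s x\<^sub>j t\<close>.
\<close>

definition middle ::
  "('g + 'g) ncpoly \<Rightarrow> 'g \<Rightarrow> ('g + 'g) list \<Rightarrow> 'g \<Rightarrow> ('g + 'g) list \<Rightarrow> ('g + 'g) ncpoly" where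
  "middle p i u j t = Poly_Mapping.map_key (\<lambda>s. rev u @ Inr i # s @ Inr j # t) p"

lemma lookup_middle:
  "Poly_Mapping.lookup (middle p i u j t) s = Poly_Mapping.lookup p (rev u @ Inr i # s @ Inr j # t)"
  unfolding middle_def by (subst map_key.rep_eq) (auto simp: inj_on_def)

text \<open>
  A word with two marked occurrences of \<open>x\<close> is the same as a pair of labels \<open>(i, u)\<close>,
  \<open>(j, t)\<close> together with the word between the marks, which reindexes the sum.
\<close>

lemma hess_form_eq_block:
  assumes F: "finite F" and supp: "\<And>i u. (i, u) \<notin> F \<Longrightarrow> y i u = (\<lambda>r. 0)"
  shows "hess_form n T p y = (\<Sum>(i, u)\<in>F. \<Sum>(j, t)\<in>F.
    dot n (y i u) (act_poly n T (middle p i u j t) (y j t)))"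
proof -
  let ?val = "\<lambda>w s i s' j t'. Poly_Mapping.lookup p w * dot n (y i (rev s)) (act_word n T s' (y j t'))"
  let ?L = "SIGMA w : Poly_Mapping.keys p. SIGMA x : x_splits w. x_splits (snd (snd x))"
  let ?R = "SIGMA ab : F \<times> F. Poly_Mapping.keys
      (middle p (fst (fst ab)) (snd (fst ab)) (fst (snd ab)) (snd (snd ab)))"
  have dot_lin: "dot n g (lin_term n T y t) = (\<Sum>(s', j, t')\<in>x_splits t. dot n g (act_word n T s' (y j t')))"
    for g t
    unfolding dot_def lin_term_eq_sum case_prod_unfold sum_distrib_left by (rule sum.swap)
  have "hess_form n T p y = (\<Sum>w\<in>Poly_Mapping.keys p. \<Sum>x\<in>x_splits w. \<Sum>z\<in>x_splits (snd (snd x)).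
      ?val w (fst x) (fst (snd x)) (fst z) (fst (snd z)) (snd (snd z)))"
    unfolding hess_form_def quad_term_eq_sum dot_lin
    by (simp add: sum_distrib_left case_prod_unfold)
  also have "\<dots> = (\<Sum>q\<in>?L. ?val (fst q) (fst (fst (snd q))) (fst (snd (fst (snd q))))
      (fst (snd (snd q))) (fst (snd (snd (snd q)))) (snd (snd (snd (snd q)))))"
    by (simp add: sum.Sigma case_prod_unfold)
  also have "\<dots> = (\<Sum>(((i, u), (j, t)), s)\<in>?R. Poly_Mapping.lookup (middle p i u j t) s
      * dot n (y i u) (act_word n T s (y j t)))"
  \<comment> \<open>Decompositions with a label outside \<open>F\<close> have no counterpart on the right; \<open>y\<close> vanishes there.\<close>
  proof (rule sum.reindex_bij_witness_not_neutral
      [where S' = "{q \<in> ?L. (fst (snd (fst (snd q))), rev (fst (fst (snd q)))) \<notin> F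
                     \<or> (fst (snd (snd (snd q))), snd (snd (snd (snd q)))) \<notin> F}"
        and T' = "{}"
        and j = "\<lambda>(w, (s, i, t), (s', j, t')). (((i, rev s), (j, t')), s')"
        and i = "\<lambda>(((i, u), (j, t)), s). (rev u @ Inr i # s @ Inr j # t,
                   (rev u, i, s @ Inr j # t), (s, j, t))"])
    show "finite {q \<in> ?L. (fst (snd (fst (snd q))), rev (fst (fst (snd q)))) \<notin> F
                     \<or> (fst (snd (snd (snd q))), snd (snd (snd (snd q)))) \<notin> F}"
      by (rule finite_subset[of _ ?L]) (auto intro!: finite_SigmaI)
  qed (auto simp: x_splits_def in_keys_iff lookup_middle supp)
  also have "\<dots> = (\<Sum>ab\<in>F \<times> F. dot n (y (fst (fst ab)) (snd (fst ab)))
      (act_poly n T (middle p (fst (fst ab)) (snd (fst ab)) (fst (snd ab)) (snd (snd ab)))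
        (y (fst (snd ab)) (snd (snd ab)))))"
    unfolding dot_act_poly using F by (simp add: sum.Sigma case_prod_unfold)
  also have "\<dots> = (\<Sum>(i, u)\<in>F. \<Sum>(j, t)\<in>F.
    dot n (y i u) (act_poly n T (middle p i u j t) (y j t)))"
    by (simp add: sum.cartesian_product case_prod_unfold)
  finally show ?thesis .
qed

section \<open>The degree in x is at most two\<close>

lemma act_poly_scale: "act_poly n T p (\<lambda>r. c * f r) r = c * act_poly n T p f r"
proof -
  have "act_word n T w (\<lambda>r. c * f r) = (\<lambda>r. c * act_word n T w f r)" for w
    by (induction w) (simp_all add: act_def sum_distrib_left mult.left_commute)
  then show ?thesis by (simp add: act_poly_def sum_distrib_left mult.left_commute)
qed

lemma x_split_first:
  assumes "word_xdeg w > 0"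
  obtains s i t where "w = s @ Inr i # t" "word_xdeg s = 0"
proof -
  have "\<exists>s i t. w = s @ Inr i # t \<and> word_xdeg s = 0"
    using assms
  proof (induction w)
    case (Cons v w)
    show ?case
    proof (cases v)
      case (Inl k)
      then obtain s i t where "w = s @ Inr i # t" "word_xdeg s = 0"
        using Cons by auto
      then show ?thesis using Inl by (intro exI[of _ "v # s"] exI[of _ i] exI[of _ t]) auto
    next
      case (Inr i)
      then show ?thesis by (intro exI[of _ "[]"] exI[of _ i] exI[of _ w]) auto
    qed
  qed simp
  then show thesis using that by blast
qed

lemma invol_middle:
  assumes "symmetric_poly p"
  shows "invol (middle p i u j t) = middle p j t i u"
proof (rule poly_mapping_eqI)
  fix s
  have "Poly_Mapping.lookup p (rev u @ Inr i # rev s @ Inr j # t)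
      = Poly_Mapping.lookup p (rev (rev u @ Inr i # rev s @ Inr j # t))"
    using assms lookup_invol[of p] by (metis symmetric_poly_def)
  then show "Poly_Mapping.lookup (invol (middle p i u j t)) s
      = Poly_Mapping.lookup (middle p j t i u) s"
    by (simp add: lookup_invol lookup_middle)
qed

lemma linear_nonneg_imp_slope_zero:
  fixes a b :: real
  assumes "\<And>t. 0 \<le> a + t * b"
  shows "b = 0"
proof (rule ccontr)
  assume "b \<noteq> 0"
  then show False using assms[of "(- a - 1) / b"] by simp
qed

text \<open>
  A positive semidefinite matrix with a zero diagonal entry has zeros in the whole row
  and column of that entry: scaling the second of two border vectors by \<open>s\<close> leaves a
  form that is affine in \<open>s\<close> and nonnegative for all real \<open>s\<close>.
\<close>

lemma middle_entry_zero:
  fixes W :: "nat \<Rightarrow> ('g::finite) mat_pair set"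
  assumes W: "is_domain W" "nonempty_domain W" "open_domain W"
    and p: "symmetric_poly p" "convex_in_x p W"
    and n: "n \<ge> 1" and AX: "(A, X) \<in> W n"
    and ne: "(i, u) \<noteq> (j, t)" and zero: "middle p j t j t = 0"
  shows "dot n f (act_poly n (case_sum A X) (middle p i u j t) g) = 0"
proof -
  let ?T = "case_sum A X"
  have T: "?T \<in> sym_tuples n"
    using W(1) n AX by (auto simp: is_domain_def sym_pairs_def)
  let ?c = "dot n f (act_poly n ?T (middle p i u j t) g)"
  have "0 \<le> dot n f (act_poly n ?T (middle p i u i u) f) + s * (2 * ?c)" for s
  proof -
    define y where "y a b = (if (a, b) = (i, u) then f
      else if (a, b) = (j, t) then (\<lambda>r. s * g r) else (\<lambda>r. 0))" for a b
    have "0 \<le> hess_form n ?T p y"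
      by (rule hess_form_nonneg[OF W p n AX])
    also have "\<dots> = (\<Sum>(a, b)\<in>{(i, u), (j, t)}. \<Sum>(c, d)\<in>{(i, u), (j, t)}.
        dot n (y a b) (act_poly n ?T (middle p a b c d) (y c d)))"
      by (rule hess_form_eq_block) (auto simp: y_def)
    also have "\<dots> = dot n f (act_poly n ?T (middle p i u i u) f)
        + dot n f (act_poly n ?T (middle p i u j t) (\<lambda>r. s * g r))
        + dot n (\<lambda>r. s * g r) (act_poly n ?T (middle p j t i u) f)
        + dot n (\<lambda>r. s * g r) (act_poly n ?T (middle p j t j t) (\<lambda>r. s * g r))"
    proof -
      have "y i u = f" "y j t = (\<lambda>r. s * g r)" using ne by (auto simp: y_def)
      then show ?thesis using ne by simp
    qed
    also have "dot n f (act_poly n ?T (middle p i u j t) (\<lambda>r. s * g r)) = s * ?c"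
      by (simp add: dot_def act_poly_scale sum_distrib_left mult.left_commute)
    also have "dot n (\<lambda>r. s * g r) (act_poly n ?T (middle p j t i u) f)
        = s * dot n g (act_poly n ?T (invol (middle p i u j t)) f)"
      by (simp add: dot_def sum_distrib_left mult.assoc invol_middle[OF p(1)])
    also have "\<dots> = s * ?c"
      by (simp only: dot_act_poly_invol[OF T])
    also have "dot n (\<lambda>r. s * g r) (act_poly n ?T (middle p j t j t) (\<lambda>r. s * g r)) = 0"
      by (simp add: zero dot_act_poly)
    finally show ?thesis by (simp add: algebra_simps)
  qed
  then show ?thesis using linear_nonneg_imp_slope_zero by fastforce
qed

lemma xdegree_attained:
  assumes "xdegree p > 0"
  obtains w where "w \<in> Poly_Mapping.keys p" "word_xdeg w = xdegree p"
proof -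
  have "xdegree p \<in> insert 0 (word_xdeg ` Poly_Mapping.keys p)"
    unfolding xdegree_def by (rule Max_in) auto
  then show thesis using assms that by auto
qed

text \<open>
  The marks are put on the first two occurrences of \<open>x\<close>, which gives the right label \<open>t\<close>
  the largest possible degree \<open>d - 2\<close>.
\<close>

theorem xdegree_le_2:
  fixes W :: "nat \<Rightarrow> ('g::finite) mat_pair set"
  assumes W: "is_domain W" "nonempty_domain W" "open_domain W"
    and p: "symmetric_poly p" "convex_in_x p W"
  shows "xdegree p \<le> 2"
proof (rule ccontr)
  assume "\<not> xdegree p \<le> 2"
  then have deg: "xdegree p \<ge> 3" by simp
  obtain w where w: "w \<in> Poly_Mapping.keys p" "word_xdeg w = xdegree p"
    using xdegree_attained[of p] deg by auto
  obtain u i w' where w1: "w = u @ Inr i # w'" "word_xdeg u = 0"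
    using x_split_first[of w] w deg by auto
  then have "word_xdeg w' = xdegree p - 1" using w by simp
  then obtain s j t where w2: "w' = s @ Inr j # t" "word_xdeg s = 0"
    using x_split_first[of w'] deg by auto
  then have t: "word_xdeg t = xdegree p - 2"
    using w w1 by simp
  have zero: "middle p j t j t = 0"
  proof (rule poly_mapping_eqI)
    fix s'
    have "word_xdeg (rev t @ Inr j # s' @ Inr j # t) > xdegree p"
      using t deg by simp
    then have "rev t @ Inr j # s' @ Inr j # t \<notin> Poly_Mapping.keys p"
      using word_xdeg_le_xdegree by (metis not_less)
    then show "Poly_Mapping.lookup (middle p j t j t) s' = Poly_Mapping.lookup 0 s'"
      by (simp add: lookup_middle in_keys_iff)
  qed
  have ne: "(i, rev u) \<noteq> (j, t)"
  proof
    assume "(i, rev u) = (j, t)"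
    then have "word_xdeg (rev u) = word_xdeg t" by simp
    then show False using t deg w1 by simp
  qed
  let ?q = "middle p i (rev u) j t"
  have s: "Poly_Mapping.lookup ?q s \<noteq> 0"
    using w(1) by (simp add: lookup_middle w1 w2 in_keys_iff)
  define D where "D = Max (insert 0 (length ` Poly_Mapping.keys ?q))"
  have D: "length v \<le> D" if "v \<in> Poly_Mapping.keys ?q" for v
    using that by (simp add: D_def)
  obtain m B Y f d where m: "m \<ge> 1" and BY: "(B, Y) \<in> W m"
    and d: "\<And>u w. length u \<le> D \<Longrightarrow> length w \<le> D \<Longrightarrow>
       dot m (d u) (act_word m (case_sum B Y) w f) = (if u = w then 1 else 0)"
    by (rule exists_separating_point[OF W, of D]) blast
  have "0 = dot m (d s) (act_poly m (case_sum B Y) ?q f)"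
    by (simp add: middle_entry_zero[OF W p m BY ne zero])
  also have "\<dots> = (\<Sum>v\<in>Poly_Mapping.keys ?q. if v = s then Poly_Mapping.lookup ?q s else 0)"
    unfolding dot_act_poly using D s by (intro sum.cong refl) (auto simp: d in_keys_iff)
  also have "\<dots> = Poly_Mapping.lookup ?q s"
    using s by (simp add: in_keys_iff)
  finally show False using s by simp
qed

section \<open>Convexity over the whole fibre\<close>

lemma lin_term_xdeg_0: "word_xdeg w = 0 \<Longrightarrow> lin_term n T y w = (\<lambda>r. 0)"
proof (induction w)
  case (Cons v w)
  then show ?case by (cases v) auto
qed simp

lemma lin_term_xdeg_1:
  "word_xdeg w \<le> 1 \<Longrightarrow> lin_term n (case_sum A X) y w = lin_term n (case_sum A Y) y w"
proof (induction w)
  case (Cons v w)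
  then show ?case by (cases v) (auto simp: lin_term_xdeg_0)
qed simp

lemma quad_term_xdeg_2:
  "word_xdeg w \<le> 2 \<Longrightarrow> quad_term n (case_sum A X) y u w = quad_term n (case_sum A Y) y u w"
proof (induction w arbitrary: u)
  case (Cons v w)
  then show ?case by (cases v) (auto simp: lin_term_xdeg_1[where X = X and Y = Y])
qed simp

text \<open>
  In a word with two occurrences of \<open>x\<close>, both are used up by the marks and what remains
  is evaluated at \<open>A\<close> alone.
\<close>

lemma hess_form_fibre:
  assumes "xdegree p \<le> 2"
  shows "hess_form n (case_sum A X) p y = hess_form n (case_sum A Y) p y"
proof -
  have "quad_term n (case_sum A X) y u w = quad_term n (case_sum A Y) y u w"
    if "w \<in> Poly_Mapping.keys p" for u w
    using word_xdeg_le_xdegree[OF that] assms by (intro quad_term_xdeg_2) simp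
  then show ?thesis unfolding hess_form_def by (intro sum.cong) auto
qed

lemma convex_of_degree_2:
  fixes q :: "real poly"
  assumes "degree q \<le> 2" "0 \<le> coeff q 2" "0 \<le> t" "t \<le> 1"
  shows "0 \<le> t * poly q 1 + (1 - t) * poly q 0 - poly q t"
proof -
  obtain a b c s where abc: "q = pCons a (pCons b (pCons c s))"
    by (metis pCons_cases)
  have "s = 0"
  proof (rule ccontr)
    assume "s \<noteq> 0"
    then show False using assms(1) by (simp add: abc)
  qed
  then have q: "poly q x = coeff q 0 + coeff q 1 * x + coeff q 2 * x\<^sup>2" for x
    by (simp add: abc numeral_2_eq_2 power2_eq_square algebra_simps)
  have "t * poly q 1 + (1 - t) * poly q 0 - poly q t = coeff q 2 * (t * (1 - t))"
    by (simp add: q algebra_simps power2_eq_square)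
  then show ?thesis using assms by simp
qed

text \<open>
  The convexity defect along a segment is \<open>t (1 - t)\<close> times the Hessian form, which is
  nonnegative because it can be computed at any other point over \<open>A\<close>, such as one in the
  domain.
\<close>

lemma convex_on_product:
  fixes W :: "nat \<Rightarrow> ('g::finite) mat_pair set"
  assumes W: "is_domain W" "nonempty_domain W" "open_domain W"
    and p: "symmetric_poly p" "convex_in_x p W"
  shows "convex_in_x p (product_domain (proj_a W) sym_tuples)"
  unfolding convex_in_x_def
proof (intro allI impI ballI)
  fix n :: nat and A X Y :: "'g mat_tuple" and t :: real
  assume n: "n \<ge> 1" and "(A, X) \<in> product_domain (proj_a W) sym_tuples n"
    and "(A, Y) \<in> product_domain (proj_a W) sym_tuples n" and t: "t \<in> {0..1}"
  then obtain X0 where sym: "A \<in> sym_tuples n" "X \<in> sym_tuples n" "Y \<in> sym_tuples n"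
    and AX0: "(A, X0) \<in> W n"
    by (auto simp: product_domain_def proj_a_def)
  have dims: "dim_row (X k) = n" "dim_col (X k) = n" "dim_row (Y k) = n" "dim_col (Y k) = n" for k
    using sym by (auto simp: sym_tuples_def)
  define H where "H = (\<lambda>k. X k + (- 1) \<cdot>\<^sub>m Y k)"
  have H_entry: "H k $$ (r, c) = X k $$ (r, c) - Y k $$ (r, c)" if "r < n" "c < n" for k r c
    using that by (simp add: H_def dims)
  have H: "H \<in> sym_tuples n"
  proof -
    have "H k \<in> carrier_mat n n" for k by (rule carrier_matI) (simp_all add: H_def dims)
    moreover have "H k $$ (r, c) = H k $$ (c, r)" if "r < n" "c < n" for k r c
      using that sym_tuples_entry[OF sym(2) that] sym_tuples_entry[OF sym(3) that]
      by (simp add: H_entry)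
    ultimately show ?thesis unfolding sym_tuples_iff_entry by blast
  qed
  let ?Z = "convex_comb t X Y"
  have Z_entry: "?Z k $$ (r, c) = t * X k $$ (r, c) + (1 - t) * Y k $$ (r, c)"
    if "r < n" "c < n" for k r c
    using that by (simp add: convex_comb_def dims)
  have Z: "?Z \<in> sym_tuples n"
  proof -
    have "?Z k \<in> carrier_mat n n" for k by (rule carrier_matI) (simp_all add: convex_comb_def dims)
    moreover have "?Z k $$ (r, c) = ?Z k $$ (c, r)" if "r < n" "c < n" for k r c
      using that sym_tuples_entry[OF sym(2) that] sym_tuples_entry[OF sym(3) that]
      by (simp add: Z_entry)
    ultimately show ?thesis unfolding sym_tuples_iff_entry by blast
  qed
  have "0 \<le> t * dot n f (act_poly n (case_sum A X) p f) + (1 - t) * dot n f (act_poly n (case_sum A Y) p f)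
      - dot n f (act_poly n (case_sum A ?Z) p f)" for f
  proof -
    let ?q = "line_form n A Y H p f"
    note car = sym_tuples_carrier[OF sym(3)] sym_tuples_carrier[OF H]
    have "poly ?q 1 = dot n f (act_poly n (case_sum A X) p f)"
      by (rule poly_line_form[OF car]) (simp add: H_entry)
    moreover have "poly ?q 0 = dot n f (act_poly n (case_sum A Y) p f)"
      by (rule poly_line_form[OF car]) simp
    moreover have "poly ?q t = dot n f (act_poly n (case_sum A ?Z) p f)"
      by (rule poly_line_form[OF car]) (simp add: H_entry Z_entry algebra_simps)
    moreover have "0 \<le> t * poly ?q 1 + (1 - t) * poly ?q 0 - poly ?q t"
    proof (rule convex_of_degree_2)
      show "degree ?q \<le> 2"
        using degree_line_form xdegree_le_2[OF W p] by (rule order_trans)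
      have "coeff ?q 2 = hess_form n (case_sum A X0) p (border n (case_sum A Y) H f)"
        using sym H hess_form_fibre[OF xdegree_le_2[OF W p]] by (simp add: coeff_line_form_2)
      then show "0 \<le> coeff ?q 2"
        using hess_form_nonneg[OF W p n AX0] by simp
    qed (use t in auto)
    ultimately show ?thesis by simp
  qed
  then show "psd n (t \<cdot>\<^sub>m eval_ax n A X p + (1 - t) \<cdot>\<^sub>m eval_ax n A Y p - eval_ax n A ?Z p)"
    unfolding eval_ax_def using sym Z p(1) by (subst psd_eval_iff) auto
qed

section \<open>The factorization\<close>

text \<open>
  The entries of the middle matrix with labels in the variables \<open>a\<close>, read as polynomials
  in \<open>a\<close> by keeping only the words between the marks that contain no \<open>x\<close>.
\<close>

definition middle_a ::
  "('g + 'g) ncpoly \<Rightarrow> 'g \<Rightarrow> 'g list \<Rightarrow> 'g \<Rightarrow> 'g list \<Rightarrow> 'g ncpoly" where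
  "middle_a p i u j t
     = Poly_Mapping.map_key (\<lambda>s. rev (map Inl u) @ Inr i # map Inl s @ Inr j # map Inl t) p"

lemma lookup_middle_a:
  "Poly_Mapping.lookup (middle_a p i u j t) s
     = Poly_Mapping.lookup p (rev (map Inl u) @ Inr i # map Inl s @ Inr j # map Inl t)"
  unfolding middle_a_def by (subst map_key.rep_eq) (auto simp: inj_on_def map_injective)

lemma map_Inl_of_xdeg_0:
  assumes "word_xdeg w = 0"
  obtains s where "w = map Inl s"
proof -
  have "\<exists>s. w = map Inl s"
    using assms
  proof (induction w)
    case (Cons v w)
    then obtain k s where "v = Inl k" "w = map Inl s" by (cases v) auto
    then show ?case by (intro exI[of _ "k # s"]) simp
  qed simp
  then show thesis using that by blast
qed

lemma act_word_map_Inl: "act_word n (case_sum A X) (map Inl s) f = act_word n A s f"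
  by (induction s) simp_all

lemma act_poly_middle_a:
  assumes "xdegree p \<le> 2"
  shows "act_poly n (case_sum A X) (middle p i (map Inl u) j (map Inl t)) f
    = act_poly n A (middle_a p i u j t) f"
proof
  fix r
  let ?q = "middle p i (map Inl u) j (map Inl t)"
  have keys: "Poly_Mapping.keys ?q = map Inl ` Poly_Mapping.keys (middle_a p i u j t)"
  proof (intro equalityI subsetI)
    fix w assume w: "w \<in> Poly_Mapping.keys ?q"
    then have "word_xdeg (rev (map Inl u) @ Inr i # w @ Inr j # map Inl t) \<le> xdegree p"
      by (intro word_xdeg_le_xdegree) (simp add: in_keys_iff lookup_middle)
    then have "word_xdeg w = 0" using assms by simp
    then obtain s where "w = map Inl s" by (rule map_Inl_of_xdeg_0)
    then show "w \<in> map Inl ` Poly_Mapping.keys (middle_a p i u j t)"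
      using w by (simp add: in_keys_iff lookup_middle lookup_middle_a image_iff)
  qed (auto simp: in_keys_iff lookup_middle lookup_middle_a)
  have inj: "inj_on (map Inl) (Poly_Mapping.keys (middle_a p i u j t))"
    by (auto simp: inj_on_def map_injective)
  show "act_poly n (case_sum A X) ?q f r = act_poly n A (middle_a p i u j t) f r"
    unfolding act_poly_def keys sum.reindex[OF inj]
    by (simp add: act_word_map_Inl lookup_middle lookup_middle_a)
qed

lemma invol_middle_a:
  assumes "symmetric_poly p"
  shows "invol (middle_a p i u j t) = middle_a p j t i u"
proof (rule poly_mapping_eqI)
  fix s
  have "Poly_Mapping.lookup p (rev (map Inl u) @ Inr i # map Inl (rev s) @ Inr j # map Inl t)
      = Poly_Mapping.lookup p (rev (rev (map Inl u) @ Inr i # map Inl (rev s) @ Inr j # map Inl t))"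
    using assms lookup_invol[of p] by (metis symmetric_poly_def)
  then show "Poly_Mapping.lookup (invol (middle_a p i u j t)) s
      = Poly_Mapping.lookup (middle_a p j t i u) s"
    by (simp add: lookup_invol lookup_middle_a rev_map)
qed

definition middle_mat :: "('g + 'g) ncpoly \<Rightarrow> ('g \<times> 'g list) list \<Rightarrow> 'g ncpoly mat" where
  "middle_mat p B = mat (length B) (length B)
     (\<lambda>(k, l). middle_a p (fst (B ! k)) (snd (B ! k)) (fst (B ! l)) (snd (B ! l)))"

definition border_poly :: "('g \<times> 'g list) list \<Rightarrow> ('g + 'g) ncpoly mat" where
  "border_poly B = mat (length B) 1
     (\<lambda>(k, _). Poly_Mapping.single (Inr (fst (B ! k)) # map Inl (snd (B ! k))) 1)"

lemma invol_middle_mat: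
  assumes "symmetric_poly p"
  shows "invol_mat (middle_mat p B) = middle_mat p B"
  by (rule eq_matI) (auto simp: invol_mat_def middle_mat_def invol_middle_a[OF assms])

lemma sum_blocks: "(\<Sum>i<N * n. g i) = (\<Sum>k<N. \<Sum>r<n. g (k * n + r))" for g :: "nat \<Rightarrow> real"
proof (induction N)
  case (Suc N)
  have "(\<Sum>i<Suc N * n. g i) = (\<Sum>i<N * n + n. g i)" by (simp add: add.commute)
  then show ?case using Suc by (simp add: sum_lessThan_add)
qed simp

text \<open>
  The quadratic form of the block matrix at \<open>f\<close> is the Hessian form of the family whose
  vector at the label \<open>B ! k\<close> is the \<open>k\<close>-th block of \<open>f\<close>, and zero at labels outside the
  list.
\<close>

lemma psd_eval_middle_mat:
  fixes W :: "nat \<Rightarrow> ('g::finite) mat_pair set"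
  assumes W: "is_domain W" "nonempty_domain W" "open_domain W"
    and p: "symmetric_poly p" "convex_in_x p W"
    and n: "n \<ge> 1" and A: "A \<in> proj_a W n" and B: "distinct B"
  shows "psd (length B * n) (eval_mat n A (middle_mat p B))"
proof -
  obtain X where AX: "(A, X) \<in> W n" and sym: "A \<in> sym_tuples n"
    using A by (auto simp: proj_a_def)
  define N where "N = length B"
  define Z where "Z k l = middle_a p (fst (B ! k)) (snd (B ! k)) (fst (B ! l)) (snd (B ! l))" for k l
  let ?M = "eval_mat n A (middle_mat p B)"
  have dims: "dim_row ?M = N * n" "dim_col ?M = N * n"
    by (simp_all add: eval_mat_def middle_mat_def N_def)
  have entry: "?M $$ (i, j) = eval_poly n A (Z (i div n) (j div n)) $$ (i mod n, j mod n)"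
    if "i < N * n" "j < N * n" for i j
  proof -
    have "i div n < length B" "j div n < length B"
      using that n by (simp_all add: N_def less_mult_imp_div_less)
    then show ?thesis
      using that by (simp add: eval_mat_def middle_mat_def N_def Z_def)
  qed
  have "transpose_mat ?M = ?M"
  proof (rule eq_matI)
    fix i j assume "i < dim_row ?M" "j < dim_col ?M"
    then have ij: "i < N * n" "j < N * n" by (simp_all add: dims)
    have "eval_poly n A (invol (Z (i div n) (j div n))) $$ (j mod n, i mod n)
        = eval_poly n A (Z (i div n) (j div n)) $$ (i mod n, j mod n)"
      using sym n by (intro eval_poly_invol) auto
    then have "?M $$ (j, i) = ?M $$ (i, j)"
      unfolding entry[OF ij] entry[OF ij(2) ij(1)] by (simp add: Z_def invol_middle_a[OF p(1)])
    then show "transpose_mat ?M $$ (i, j) = ?M $$ (i, j)"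
      using ij by (simp add: dims)
  qed (simp_all add: dims)
  moreover have "0 \<le> dot (N * n) f (act (N * n) ?M f)" for f
  proof -
    define e where "e k = (fst (B ! k), map Inl (snd (B ! k)) :: ('g + 'g) list)" for k
    have inj: "inj_on e {..<N}"
      using B by (auto simp: inj_on_def e_def N_def map_injective prod_eq_iff
          nth_eq_iff_index_eq[symmetric])
    define y where "y i u = (if (i, u) \<in> e ` {..<N}
        then (\<lambda>r. f (the_inv_into {..<N} e (i, u) * n + r)) else (\<lambda>r. 0))" for i u
    have y_e: "y (fst (e k)) (snd (e k)) = (\<lambda>r. f (k * n + r))" if "k < N" for k
      using that inj by (simp add: y_def the_inv_into_f_f)
    have "0 \<le> hess_form n (case_sum A X) p y"
      by (rule hess_form_nonneg[OF W p n AX])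
    also have "\<dots> = (\<Sum>(i, u)\<in>e ` {..<N}. \<Sum>(j, t)\<in>e ` {..<N}.
        dot n (y i u) (act_poly n (case_sum A X) (middle p i u j t) (y j t)))"
      by (rule hess_form_eq_block) (auto simp: y_def)
    also have "\<dots> = (\<Sum>k<N. \<Sum>l<N. dot n (y (fst (e k)) (snd (e k))) (act_poly n (case_sum A X)
        (middle p (fst (e k)) (snd (e k)) (fst (e l)) (snd (e l))) (y (fst (e l)) (snd (e l)))))"
      by (simp add: sum.reindex[OF inj] case_prod_unfold comp_def)
    also have "\<dots> = (\<Sum>k<N. \<Sum>l<N. dot n (\<lambda>r. f (k * n + r))
        (act_poly n A (Z k l) (\<lambda>r. f (l * n + r))))"
      by (intro sum.cong refl)
         (simp add: y_e, simp add: e_def Z_def act_poly_middle_a[OF xdegree_le_2[OF W p]])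
    also have "\<dots> = (\<Sum>k<N. \<Sum>l<N. \<Sum>r<n. \<Sum>c<n.
        f (k * n + r) * (?M $$ (k * n + r, l * n + c) * f (l * n + c)))"
    proof (intro sum.cong refl)
      fix k l assume kl: "k \<in> {..<N}" "l \<in> {..<N}"
      have idx: "k' * n + r < N * n" if "k' < N" "r < n" for k' r
      proof -
        have "k' * n + r < Suc k' * n" using that by simp
        also have "\<dots> \<le> N * n" using that by (intro mult_right_mono) auto
        finally show ?thesis .
      qed
      have "dot n (\<lambda>r. f (k * n + r)) (act_poly n A (Z k l) (\<lambda>r. f (l * n + r)))
          = dot n (\<lambda>r. f (k * n + r)) (act n (eval_poly n A (Z k l)) (\<lambda>r. f (l * n + r)))"
        by (intro dot_cong refl) (simp add: act_eval_poly sym_tuples_carrier[OF sym])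
      also have "\<dots> = (\<Sum>r<n. \<Sum>c<n. f (k * n + r) *
          (eval_poly n A (Z k l) $$ (r, c) * f (l * n + c)))"
        by (simp add: dot_def act_def sum_distrib_left)
      also have "\<dots> = (\<Sum>r<n. \<Sum>c<n.
          f (k * n + r) * (?M $$ (k * n + r, l * n + c) * f (l * n + c)))"
        using kl by (intro sum.cong refl) (simp add: entry idx)
      finally show "dot n (\<lambda>r. f (k * n + r)) (act_poly n A (Z k l) (\<lambda>r. f (l * n + r)))
          = (\<Sum>r<n. \<Sum>c<n. f (k * n + r) * (?M $$ (k * n + r, l * n + c) * f (l * n + c)))" .
    qed
    also have "\<dots> = (\<Sum>k<N. \<Sum>r<n. \<Sum>l<N. \<Sum>c<n.
        f (k * n + r) * (?M $$ (k * n + r, l * n + c) * f (l * n + c)))"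
      by (intro sum.cong refl sum.swap)
    also have "\<dots> = dot (N * n) f (act (N * n) ?M f)"
      by (simp add: dot_def act_def sum_blocks sum_distrib_left)
    finally show ?thesis .
  qed
  ultimately show ?thesis
    unfolding psd_iff_dot N_def[symmetric] using carrier_matI[OF dims] by simp
qed

lemma invol_single: "invol (Poly_Mapping.single w c) = Poly_Mapping.single (rev w) c"
  by (rule poly_mapping_eqI) (auto simp: lookup_invol lookup_single when_def)

text \<open>
  A word of degree two in \<open>x\<close> factors in exactly one way as \<open>u\<^sup>T x\<^sub>i s x\<^sub>j t\<close> with \<open>u\<close>,
  \<open>s\<close>, \<open>t\<close> in \<open>a\<close>. Hence each such word of \<open>p\<close> occurs exactly once when the product is
  multiplied out.
\<close>

lemma lookup_border_product:
  fixes p :: "('g + 'g) ncpoly"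
  assumes B: "distinct B" and all: "\<And>i u. length u \<le> D \<Longrightarrow> (i, u) \<in> set B"
    and D: "\<And>w. w \<in> Poly_Mapping.keys p \<Longrightarrow> length w \<le> D"
  shows "Poly_Mapping.lookup
      ((invol_mat (border_poly B) * map_mat embed_a (middle_mat p B) * border_poly B) $$ (0, 0)) w
    = (if word_xdeg w = 2 then Poly_Mapping.lookup p w else 0)"
proof -
  define N where "N = length B"
  define I where "I k = fst (B ! k)" for k
  define U where "U k = (map Inl (snd (B ! k)) :: ('g + 'g) list)" for k
  define Z where "Z k l = middle_a p (fst (B ! k)) (snd (B ! k)) (fst (B ! l)) (snd (B ! l))" for k l
  define word where "word k l s = rev (U k) @ Inr (I k) # map Inl s @ Inr (I l) # U l" for k l s
  let ?E = "(invol_mat (border_poly B) * map_mat embed_a (middle_mat p B) * border_poly B) $$ (0, 0)"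
  have "?E = (\<Sum>l<N. (\<Sum>k<N. Poly_Mapping.single (rev (U k) @ [Inr (I k)]) 1 * embed_a (Z k l))
      * Poly_Mapping.single (Inr (I l) # U l) 1)"
    by (simp add: invol_mat_def border_poly_def middle_mat_def scalar_prod_def N_def I_def U_def
        Z_def lessThan_atLeast0 invol_single)
  also have "\<dots> = (\<Sum>l<N. \<Sum>k<N. \<Sum>s\<in>Poly_Mapping.keys (Z k l).
      Poly_Mapping.single (word k l s) (Poly_Mapping.lookup p (word k l s)))"
    unfolding embed_a_def sum_distrib_left sum_distrib_right
    by (intro sum.cong refl)
       (simp add: mult_single plus_list_def Z_def lookup_middle_a word_def I_def U_def)
  finally have E: "?E = \<dots>" .
  let ?R = "SIGMA l : {..<N}. SIGMA k : {..<N}. Poly_Mapping.keys (Z k l)"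
  let ?w = "\<lambda>q. word (fst (snd q)) (fst q) (snd (snd q))"
  have inj: "inj_on ?w ?R"
  proof (rule inj_onI, clarsimp)
    fix l k s l' k' s'
    assume N: "l < N" "k < N" "l' < N" "k' < N" and eq: "word k l s = word k' l' s'"
    \<comment> \<open>The first letter \<open>x\<close> of a word determines where the prefix in \<open>a\<close> ends.\<close>
    have pre: "a = a' \<and> i = i' \<and> b = b'"
      if "map Inl a @ Inr i # b = map Inl a' @ Inr i' # b'"
      for a a' :: "'g list" and i i' :: 'g and b b' :: "('g + 'g) list"
      using that
    proof (induction a arbitrary: a')
      case Nil
      then show ?case by (cases a') auto
    next
      case (Cons v a)
      then show ?case by (cases a') auto
    qed
    have "snd (B ! k) = snd (B ! k') \<and> I k = I k' \<and> map Inl s @ Inr (I l) # U l = map Inl s' @ Inr (I l') # U l'"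
      using pre[of "rev (snd (B ! k))" "I k" _ "rev (snd (B ! k'))" "I k'"] eq
      by (simp add: word_def U_def rev_map)
    moreover from this have "s = s' \<and> I l = I l' \<and> U l = U l'"
      using pre by blast
    ultimately have "B ! k = B ! k'" "B ! l = B ! l'" "s = s'"
      by (auto simp: I_def U_def prod_eq_iff map_injective)
    then show "l = l' \<and> k = k' \<and> s = s'"
      using N B by (simp add: N_def nth_eq_iff_index_eq)
  qed
  have fin: "finite ?R" by (intro finite_SigmaI) auto
  have "Poly_Mapping.lookup ?E w = (\<Sum>q\<in>?R. if ?w q = w then Poly_Mapping.lookup p (?w q) else 0)"
    unfolding E lookup_sum by (simp add: lookup_single when_def sum.Sigma case_prod_unfold)
  also have "\<dots> = (\<Sum>x\<in>?w ` ?R. if x = w then Poly_Mapping.lookup p x else 0)"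
    by (subst sum.reindex[OF inj]) (simp add: comp_def)
  also have "\<dots> = (if w \<in> ?w ` ?R then Poly_Mapping.lookup p w else 0)"
    using fin by simp
  also have "\<dots> = (if word_xdeg w = 2 then Poly_Mapping.lookup p w else 0)"
  proof -
    have "word_xdeg w = 2" if "w \<in> ?w ` ?R"
      using that by (auto simp: word_def U_def)
    moreover have "w \<in> ?w ` ?R" if deg: "word_xdeg w = 2" and key: "w \<in> Poly_Mapping.keys p"
    proof -
      obtain u i w' where 1: "w = u @ Inr i # w'" "word_xdeg u = 0"
        using x_split_first[of w] deg by auto
      obtain s j t where 2: "w' = s @ Inr j # t" "word_xdeg s = 0"
        using x_split_first[of w'] deg 1 by auto
      have 3: "word_xdeg t = 0" using deg 1 2 by simp
      obtain u' where u': "rev u = map Inl u'" using map_Inl_of_xdeg_0[of "rev u"] 1 by auto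
      obtain s' where s': "s = map Inl s'" using map_Inl_of_xdeg_0 2 by blast
      obtain t' where t': "t = map Inl t'" using map_Inl_of_xdeg_0 3 by blast
      have u: "u = rev (map Inl u')" using u' by (metis rev_rev_ident)
      have len: "length u' \<le> D" "length t' \<le> D"
        using D[OF key] by (simp_all add: 1 2 u t')
      obtain k where k: "k < N" "B ! k = (i, u')"
        using all[OF len(1)] by (auto simp: in_set_conv_nth N_def)
      obtain l where l: "l < N" "B ! l = (j, t')"
        using all[OF len(2)] by (auto simp: in_set_conv_nth N_def)
      have w: "w = word k l s'"
        by (simp add: word_def I_def U_def k l 1 2 u s' t')
      have "s' \<in> Poly_Mapping.keys (Z k l)"
        using key unfolding w by (simp add: in_keys_iff Z_def lookup_middle_a word_def I_def U_def)
      then show ?thesis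
        using k l by (intro image_eqI[of _ _ "(l, k, s')"]) (simp_all add: w)
    qed
    ultimately show ?thesis by (auto simp: in_keys_iff)
  qed
  finally show ?thesis .
qed

theorem theorem1p4:
  fixes W :: "nat \<Rightarrow> ('g::finite) mat_pair set"
    and p :: "('g + 'g) ncpoly"
  assumes "is_domain W" and "nonempty_domain W" and "open_domain W"
    and "symmetric_poly p"
    and "convex_in_x p W"
  shows "(\<exists>N \<ge> 1. \<exists>L :: ('g + 'g) ncpoly.
           \<exists>(Z :: 'g ncpoly mat) \<in> carrier_mat N N.
           \<exists>(V :: ('g + 'g) ncpoly mat) \<in> carrier_mat N 1.
             p = L + (invol_mat V * map_mat embed_a Z * V) $$ (0, 0) \<and>
             invol_mat Z = Z \<and>
             (\<forall>n \<ge> 1. \<forall>A \<in> proj_a W n. psd (N * n) (eval_mat n A Z)) \<and>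
             (\<forall>i < N. x_homogeneous 1 (V $$ (i, 0))) \<and>
             symmetric_poly L \<and> xdegree L \<le> 1)
         \<and> convex_in_x p (product_domain (proj_a W) sym_tuples)
         \<and> xdegree p \<le> 2"
proof (intro conjI)
  show deg: "xdegree p \<le> 2" by (rule xdegree_le_2[OF assms])
  show "convex_in_x p (product_domain (proj_a W) sym_tuples)" by (rule convex_on_product[OF assms])
  define D where "D = Max (insert 0 (length ` Poly_Mapping.keys p))"
  have D: "length w \<le> D" if "w \<in> Poly_Mapping.keys p" for w
    using that by (simp add: D_def)
  have fin: "finite {u :: 'g list. length u \<le> D}"
    using finite_lists_length_le[of "UNIV :: 'g set" D] by simp
  obtain B :: "('g \<times> 'g list) list" where B: "set B = UNIV \<times> {u. length u \<le> D}" "distinct B"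
    using finite_distinct_list[of "UNIV \<times> {u. length u \<le> D}"] fin by (metis finite_SigmaI finite_UNIV finite)
  let ?V = "border_poly B" and ?Z = "middle_mat p B"
  let ?Q = "(invol_mat ?V * map_mat embed_a ?Z * ?V) $$ (0, 0)"
  have lookup_Q: "Poly_Mapping.lookup ?Q w = (if word_xdeg w = 2 then Poly_Mapping.lookup p w else 0)"
    for w by (rule lookup_border_product[OF B(2) _ D]) (auto simp: B)
  define L where "L = p - ?Q"
  have lookup_L: "Poly_Mapping.lookup L w = (if word_xdeg w = 2 then 0 else Poly_Mapping.lookup p w)" for w
    by (simp add: L_def lookup_minus lookup_Q)
  have sum: "p = L + ?Q"
    by (rule poly_mapping_eqI) (simp add: lookup_add lookup_L lookup_Q)
  have N: "length B \<ge> 1"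
  proof -
    have "(undefined, []) \<in> set B" by (simp add: B)
    then show ?thesis by (cases B) auto
  qed
  have symL: "symmetric_poly L"
  proof -
    have "Poly_Mapping.lookup p (rev w) = Poly_Mapping.lookup p w" for w
      using assms(4) lookup_invol[of p w] by (simp add: symmetric_poly_def)
    then show ?thesis
      unfolding symmetric_poly_def by (intro poly_mapping_eqI) (simp add: lookup_invol lookup_L)
  qed
  have degL: "xdegree L \<le> 1"
  proof -
    have "word_xdeg w \<le> 1" if "w \<in> Poly_Mapping.keys L" for w
    proof -
      have "word_xdeg w \<noteq> 2" "w \<in> Poly_Mapping.keys p"
        using that by (auto simp: in_keys_iff lookup_L split: if_splits)
      then show ?thesis using word_xdeg_le_xdegree[of w p] deg by simp
    qed
    then show ?thesis by (simp add: xdegree_def)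
  qed
  have "?Z \<in> carrier_mat (length B) (length B)" "?V \<in> carrier_mat (length B) 1"
    by (simp_all add: middle_mat_def border_poly_def)
  moreover have "\<forall>i < length B. x_homogeneous 1 (?V $$ (i, 0))"
    by (simp add: border_poly_def x_homogeneous_def)
  moreover have "\<forall>n \<ge> 1. \<forall>A \<in> proj_a W n. psd (length B * n) (eval_mat n A ?Z)"
    using psd_eval_middle_mat[OF assms _ _ B(2)] by blast
  ultimately show "\<exists>N \<ge> 1. \<exists>L :: ('g + 'g) ncpoly.
           \<exists>(Z :: 'g ncpoly mat) \<in> carrier_mat N N.
           \<exists>(V :: ('g + 'g) ncpoly mat) \<in> carrier_mat N 1.
             p = L + (invol_mat V * map_mat embed_a Z * V) $$ (0, 0) \<and>
             invol_mat Z = Z \<and>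
             (\<forall>n \<ge> 1. \<forall>A \<in> proj_a W n. psd (N * n) (eval_mat n A Z)) \<and>
             (\<forall>i < N. x_homogeneous 1 (V $$ (i, 0))) \<and>
             symmetric_poly L \<and> xdegree L \<le> 1"
    using N sum invol_middle_mat[OF assms(4)] symL degL by blast
qed

end
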